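(* Let $A$ be a commutative ring containing $\mathbb{Q}$, let $B := A[[t_1, \ldots, t_n]]$, and let $\mathfrak{b} \subseteq B$ be the ideal generated by the variables $t_1, \ldots, t_n$. Suppose $M$ is a left $\mathcal{D}_{B/A}$-module, which is $\mathfrak{b}$-adically complete as a $B$-module. If $M/\mathfrak{b} \cdot M$ is a free $A$-module, then $M$ is a $\mathfrak{b}$-adically free $B$-module.
   Context: No finiteness condition is put on $A$ or on $M$. $\mathcal{D}_{B/A}$ is the ring of $A$-linear differential operators of $B$ in the sense of Grothendieck: an operator $\theta \in \mathrm{End}_A(B)$ has differential order $\leq 0$ if it is $B$-linear, and (for $k \geq 1$) order $\leq k$ if for every $b \in B$ the operator $[b,\theta] := b \cdot \theta - \theta \cdot b$ has order $\leq k-1$; $\mathcal{D}_{B/A}$ is the subring of $\mathrm{End}_A(B)$ of all operators of finite differential order. The operators of order $\leq 0$ form the subring $B$, so a left $\mathcal{D}_{B/A}$-module is in particular a $B$-module. A $B$-module $M$ is $\mathfrak{b}$-adically complete if the canonical homomorphism $M \to \varprojlim_i M/\mathfrak{b}^i \cdot M$ is an isomorphism. A $B$-module $M$ is called $\mathfrak{b}$-adically free if $M$ is (isomorphic to) the $\mathfrak{b}$-adic completion of a free $B$-module (possibly of infinite rank). *)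

theory Defs
  imports Complex_Main "HOL-Library.Multiset" "HOL-Algebra.Generated_Groups"
    "HOL-Algebra.Ideal_Product" "HOL-Algebra.Subrings" "HOL-Algebra.Module"
begin

section \<open>Modules: homomorphisms, restriction of scalars, quotients, free modules\<close>

text \<open>The library locale \<^locale>\<open>module\<close> asks for a commutative ring of scalars.\<close>

locale left_module = R?: ring R + M?: abelian_group M for R :: "('a, 'x) ring_scheme" (structure)
    and M :: "('a, 'm, 'y) module_scheme" (structure) +
  assumes smult_closed [simp, intro]:
      "\<lbrakk>a \<in> carrier R; x \<in> carrier M\<rbrakk> \<Longrightarrow> a \<odot>\<^bsub>M\<^esub> x \<in> carrier M"
    and smult_l_distr:
      "\<lbrakk>a \<in> carrier R; b \<in> carrier R; x \<in> carrier M\<rbrakk> \<Longrightarrow>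
      (a \<oplus> b) \<odot>\<^bsub>M\<^esub> x = a \<odot>\<^bsub>M\<^esub> x \<oplus>\<^bsub>M\<^esub> b \<odot>\<^bsub>M\<^esub> x"
    and smult_r_distr:
      "\<lbrakk>a \<in> carrier R; x \<in> carrier M; y \<in> carrier M\<rbrakk> \<Longrightarrow>
      a \<odot>\<^bsub>M\<^esub> (x \<oplus>\<^bsub>M\<^esub> y) = a \<odot>\<^bsub>M\<^esub> x \<oplus>\<^bsub>M\<^esub> a \<odot>\<^bsub>M\<^esub> y"
    and smult_assoc1:
      "\<lbrakk>a \<in> carrier R; b \<in> carrier R; x \<in> carrier M\<rbrakk> \<Longrightarrow>
      (a \<otimes> b) \<odot>\<^bsub>M\<^esub> x = a \<odot>\<^bsub>M\<^esub> (b \<odot>\<^bsub>M\<^esub> x)"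
    and smult_one [simp]:
      "x \<in> carrier M \<Longrightarrow> \<one> \<odot>\<^bsub>M\<^esub> x = x"

definition mod_hom ::
    "('a, 'x) ring_scheme \<Rightarrow> ('a, 'm, 'y) module_scheme \<Rightarrow> ('a, 'k, 'z) module_scheme \<Rightarrow> ('m \<Rightarrow> 'k) set"
  where "mod_hom R M N = {h. h \<in> carrier M \<rightarrow> carrier N \<and>
      (\<forall>x\<in>carrier M. \<forall>y\<in>carrier M. h (x \<oplus>\<^bsub>M\<^esub> y) = h x \<oplus>\<^bsub>N\<^esub> h y) \<and>
      (\<forall>r\<in>carrier R. \<forall>x\<in>carrier M. h (r \<odot>\<^bsub>M\<^esub> x) = r \<odot>\<^bsub>N\<^esub> h x)}"

definition mod_iso ::
    "('a, 'x) ring_scheme \<Rightarrow> ('a, 'm, 'y) module_scheme \<Rightarrow> ('a, 'k, 'z) module_scheme \<Rightarrow> ('m \<Rightarrow> 'k) set"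
  where "mod_iso R M N = {h \<in> mod_hom R M N. bij_betw h (carrier M) (carrier N)}"

definition is_mod_iso ::
    "('a, 'x) ring_scheme \<Rightarrow> ('a, 'm, 'y) module_scheme \<Rightarrow> ('a, 'k, 'z) module_scheme \<Rightarrow> bool"
  where "is_mod_iso R M N \<longleftrightarrow> mod_iso R M N \<noteq> {}"

text \<open>Module records carry the fields of a ring; in the constructions below the
  multiplicative fields are irrelevant.\<close>

definition restrict_scalars :: "('a \<Rightarrow> 'b) \<Rightarrow> ('b, 'm, 'y) module_scheme \<Rightarrow> ('a, 'm) module"
  where "restrict_scalars f M =
    \<lparr>carrier = carrier M, mult = undefined, one = undefined,
     zero = zero M, add = add M, smult = (\<lambda>a x. f a \<odot>\<^bsub>M\<^esub> x)\<rparr>"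

definition ideal_smult ::
    "('a, 'm, 'y) module_scheme \<Rightarrow> 'a set \<Rightarrow> 'm set"
  where "ideal_smult M I = generate (add_monoid M) {r \<odot>\<^bsub>M\<^esub> x | r x. r \<in> I \<and> x \<in> carrier M}"

definition quot_module :: "('a, 'm, 'y) module_scheme \<Rightarrow> 'm set \<Rightarrow> ('a, 'm set) module"
  where "quot_module M N =
    \<lparr>carrier = a_rcosets\<^bsub>M\<^esub> N, mult = undefined, one = undefined,
     zero = N, add = set_add M, smult = (\<lambda>r X. \<Union>x\<in>X. N +>\<^bsub>M\<^esub> (r \<odot>\<^bsub>M\<^esub> x))\<rparr>"

text \<open>The direct sum of copies of \<open>R\<close> indexed by \<open>I\<close>; families are extended by zero outside \<open>I\<close>.\<close>

definition direct_sum :: "('a, 'x) ring_scheme \<Rightarrow> 'i set \<Rightarrow> ('a, 'i \<Rightarrow> 'a) module"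
  where "direct_sum R I =
    \<lparr>carrier = {f. (\<forall>i. f i \<in> carrier R) \<and> (\<forall>i. i \<notin> I \<longrightarrow> f i = \<zero>\<^bsub>R\<^esub>) \<and> finite {i. f i \<noteq> \<zero>\<^bsub>R\<^esub>}},
     mult = undefined, one = undefined,
     zero = (\<lambda>i. \<zero>\<^bsub>R\<^esub>), add = (\<lambda>f g i. f i \<oplus>\<^bsub>R\<^esub> g i), smult = (\<lambda>r f i. r \<otimes>\<^bsub>R\<^esub> f i)\<rparr>"

text \<open>Indexing by subsets of the type of elements of \<open>M\<close> is no restriction on the rank: over a
  nonzero ring a basis of \<open>M\<close> is itself such an index set, and over the zero ring \<open>M\<close> is zero.\<close>

definition free_module :: "('a, 'x) ring_scheme \<Rightarrow> ('a, 'm, 'y) module_scheme \<Rightarrow> bool"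
  where "free_module R M \<longleftrightarrow> (\<exists>I :: 'm set. is_mod_iso R M (direct_sum R I))"


section \<open>Adic completion\<close>

definition adic_sub ::
    "('a, 'x) ring_scheme \<Rightarrow> 'a set \<Rightarrow> ('a, 'm, 'y) module_scheme \<Rightarrow> nat \<Rightarrow> 'm set"
  where "adic_sub R I M i = ideal_smult M (I [^]\<^bsub>ideals_set R\<^esub> i)"

text \<open>The inverse limit of the modules \<open>M / I\<^sup>i M\<close>: families of cosets compatible under the
  canonical projections, which send a coset \<open>X\<close> of \<open>I\<^sup>j M\<close> to the coset \<open>I\<^sup>i M + X\<close>.\<close>

definition adic_completion ::
    "('a, 'x) ring_scheme \<Rightarrow> 'a set \<Rightarrow> ('a, 'm, 'y) module_scheme \<Rightarrow> ('a, nat \<Rightarrow> 'm set) module"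
  where "adic_completion R I M =
    \<lparr>carrier = {X. (\<forall>i. X i \<in> carrier (quot_module M (adic_sub R I M i))) \<and>
                  (\<forall>i j. i \<le> j \<longrightarrow> adic_sub R I M i <+>\<^bsub>M\<^esub> X j = X i)},
     mult = undefined, one = undefined,
     zero = (\<lambda>i. \<zero>\<^bsub>quot_module M (adic_sub R I M i)\<^esub>),
     add = (\<lambda>X Y i. X i \<oplus>\<^bsub>quot_module M (adic_sub R I M i)\<^esub> Y i),
     smult = (\<lambda>r X i. r \<odot>\<^bsub>quot_module M (adic_sub R I M i)\<^esub> X i)\<rparr>"

definition adically_complete ::
    "('a, 'x) ring_scheme \<Rightarrow> 'a set \<Rightarrow> ('a, 'm, 'y) module_scheme \<Rightarrow> bool"
  where "adically_complete R I M \<longleftrightarrow>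
    (\<lambda>x i. adic_sub R I M i +>\<^bsub>M\<^esub> x) \<in> mod_iso R M (adic_completion R I M)"

text \<open>Again the index set may be taken inside the type of elements of \<open>M\<close>. If \<open>R\<close> is \<open>I\<close>-adically
  separated and nonzero (as the power series ring below is), a free module embeds into its
  completion, so its basis embeds into \<open>M\<close>.\<close>

definition adically_free ::
    "('a, 'x) ring_scheme \<Rightarrow> 'a set \<Rightarrow> ('a, 'm, 'y) module_scheme \<Rightarrow> bool"
  where "adically_free R I M \<longleftrightarrow>
    (\<exists>J :: 'm set. is_mod_iso R M (adic_completion R I (direct_sum R J)))"


section \<open>Differential operators\<close>

text \<open>Endomorphisms of the \<open>A\<close>-module \<open>B\<close> are taken to be extensional functions on the carrier,
  so that equality in the endomorphism ring is equality of functions.\<close>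

definition endo_ring :: "('a, 'x) ring_scheme \<Rightarrow> ('a, 'b, 'y) module_scheme \<Rightarrow> ('b \<Rightarrow> 'b) ring"
  where "endo_ring A B =
    \<lparr>carrier = mod_hom A B B \<inter> extensional (carrier B),
     mult = compose (carrier B), one = (\<lambda>x\<in>carrier B. x),
     zero = (\<lambda>x\<in>carrier B. \<zero>\<^bsub>B\<^esub>), add = (\<lambda>f g. \<lambda>x\<in>carrier B. f x \<oplus>\<^bsub>B\<^esub> g x)\<rparr>"

definition mult_op :: "('b, 'y) ring_scheme \<Rightarrow> 'b \<Rightarrow> 'b \<Rightarrow> 'b"
  where "mult_op B b = (\<lambda>x\<in>carrier B. b \<otimes>\<^bsub>B\<^esub> x)"

primrec diff_ops_le ::
    "('a, 'x) ring_scheme \<Rightarrow> ('a, 'b, 'y) module_scheme \<Rightarrow> nat \<Rightarrow> ('b \<Rightarrow> 'b) set"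
  where
    "diff_ops_le A B 0 = {\<theta> \<in> carrier (endo_ring A B).
       \<forall>b\<in>carrier B. \<forall>x\<in>carrier B. \<theta> (b \<otimes>\<^bsub>B\<^esub> x) = b \<otimes>\<^bsub>B\<^esub> \<theta> x}"
  | "diff_ops_le A B (Suc k) = {\<theta> \<in> carrier (endo_ring A B).
       \<forall>b\<in>carrier B.
         mult_op B b \<otimes>\<^bsub>endo_ring A B\<^esub> \<theta> \<ominus>\<^bsub>endo_ring A B\<^esub> \<theta> \<otimes>\<^bsub>endo_ring A B\<^esub> mult_op B b
           \<in> diff_ops_le A B k}"

definition diff_ops :: "('a, 'x) ring_scheme \<Rightarrow> ('a, 'b, 'y) module_scheme \<Rightarrow> ('b \<Rightarrow> 'b) ring"
  where "diff_ops A B = (endo_ring A B)\<lparr>carrier := (\<Union>k. diff_ops_le A B k)\<rparr>"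


section \<open>Power series\<close>

text \<open>As in HOL-Algebra.Indexed_Polynomials, monomials are multisets of variables; the
  variables are the natural numbers below \<open>n\<close>, and a power series is its family of coefficients,
  extended by zero to all of \<open>nat multiset\<close>.\<close>

definition power_series :: "('a, 'x) ring_scheme \<Rightarrow> nat \<Rightarrow> ('a, nat multiset \<Rightarrow> 'a) module"
  where "power_series A n =
    \<lparr>carrier = {f. (\<forall>m. f m \<in> carrier A) \<and> (\<forall>m. \<not> set_mset m \<subseteq> {..<n} \<longrightarrow> f m = \<zero>\<^bsub>A\<^esub>)},
     mult = (\<lambda>f g m. \<Oplus>\<^bsub>A\<^esub>k\<in>{k. k \<subseteq># m}. f k \<otimes>\<^bsub>A\<^esub> g (m - k)),
     one = (\<lambda>m. if m = {#} then \<one>\<^bsub>A\<^esub> else \<zero>\<^bsub>A\<^esub>),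
     zero = (\<lambda>m. \<zero>\<^bsub>A\<^esub>),
     add = (\<lambda>f g m. f m \<oplus>\<^bsub>A\<^esub> g m),
     smult = (\<lambda>a f m. a \<otimes>\<^bsub>A\<^esub> f m)\<rparr>"

definition ps_var :: "('a, 'x) ring_scheme \<Rightarrow> nat \<Rightarrow> nat multiset \<Rightarrow> 'a"
  where "ps_var A i = (\<lambda>m. if m = {#i#} then \<one>\<^bsub>A\<^esub> else \<zero>\<^bsub>A\<^esub>)"

definition var_ideal :: "('a, 'x) ring_scheme \<Rightarrow> nat \<Rightarrow> (nat multiset \<Rightarrow> 'a) set"
  where "var_ideal A n = Idl\<^bsub>power_series A n\<^esub> (ps_var A ` {..<n})"

definition ps_const :: "('a, 'x) ring_scheme \<Rightarrow> nat \<Rightarrow> 'a \<Rightarrow> nat multiset \<Rightarrow> 'a"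
  where "ps_const A n a = a \<odot>\<^bsub>power_series A n\<^esub> \<one>\<^bsub>power_series A n\<^esub>"

definition rat_ring :: "rat ring"
  where "rat_ring = \<lparr>carrier = UNIV, mult = (*), one = 1, zero = 0, add = (+)\<rparr>"

definition contains_rat :: "('a, 'x) ring_scheme \<Rightarrow> bool"
  where "contains_rat A \<longleftrightarrow> (\<exists>h\<in>ring_hom rat_ring A. inj_on h (carrier rat_ring))"


section \<open>Power series and differential operators form rings\<close>

lemma finite_submultisets: "finite {k. k \<subseteq># m}" for m :: "'c multiset"
proof (induction m)
  case (add x m)
  have "{k. k \<subseteq># add_mset x m} \<subseteq> {k. k \<subseteq># m} \<union> add_mset x ` {k. k \<subseteq># m}"
  proof
    fix k assume "k \<in> {k. k \<subseteq># add_mset x m}"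
    then have k: "k \<subseteq># add_mset x m" by simp
    show "k \<in> {k. k \<subseteq># m} \<union> add_mset x ` {k. k \<subseteq># m}"
    proof (cases "x \<in># k")
      case True
      then obtain k' where k': "k = add_mset x k'" by (metis multi_member_split)
      then show ?thesis using k by auto
    next
      case False
      then have "k \<subseteq># m" using k
        by (metis add_mset_remove_trivial diff_single_trivial subset_eq_diff_conv add_mset_add_single)
      then show ?thesis by simp
    qed
  qed
  then show ?case using add.IH by (meson finite_UnI finite_imageI finite_subset)
qed simp

lemma (in abelian_monoid) finsum_Sigma:
  assumes "finite A" "\<And>a. a \<in> A \<Longrightarrow> finite (B a)"
    and "\<And>a b. a \<in> A \<Longrightarrow> b \<in> B a \<Longrightarrow> f a b \<in> carrier G"
  shows "(\<Oplus>a\<in>A. \<Oplus>b\<in>B a. f a b) = (\<Oplus>p\<in>Sigma A B. f (fst p) (snd p))"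
  using assms
proof (induction A rule: finite_induct)
  case (insert a A)
  have S: "Sigma (insert a A) B = Pair a ` B a \<union> Sigma A B" by auto
  have "(\<Oplus>p\<in>Sigma (insert a A) B. f (fst p) (snd p)) =
      (\<Oplus>p\<in>Pair a ` B a. f (fst p) (snd p)) \<oplus> (\<Oplus>p\<in>Sigma A B. f (fst p) (snd p))"
    unfolding S by (rule finsum_Un_disjoint) (use insert in \<open>auto\<close>)
  also have "(\<Oplus>p\<in>Pair a ` B a. f (fst p) (snd p)) = (\<Oplus>b\<in>B a. f a b)"
    by (subst finsum_reindex) (use insert in \<open>auto simp: inj_on_def\<close>)
  also have "(\<Oplus>p\<in>Sigma A B. f (fst p) (snd p)) = (\<Oplus>a\<in>A. \<Oplus>b\<in>B a. f a b)"
    using insert by simp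
  finally show ?case
    by (subst finsum_insert) (use insert in \<open>auto intro!: finsum_closed\<close>)
qed simp

context cring
begin

lemma ps_coeff:
  assumes "f \<in> carrier (power_series R n)" shows "f m \<in> carrier R"
  using assms by (simp add: power_series_def)

lemma ps_mult_closed:
  assumes f: "f \<in> carrier (power_series R n)" and g: "g \<in> carrier (power_series R n)"
  shows "f \<otimes>\<^bsub>power_series R n\<^esub> g \<in> carrier (power_series R n)"
proof -
  have "(\<Oplus>k\<in>{k. k \<subseteq># m}. f k \<otimes> g (m - k)) = \<zero>" if m: "\<not> set_mset m \<subseteq> {..<n}" for m
  proof -
    have "f k \<otimes> g (m - k) = \<zero>" if "k \<subseteq># m" for k
    proof (cases "set_mset k \<subseteq> {..<n}")
      case True
      then have "\<not> set_mset (m - k) \<subseteq> {..<n}"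
        using m that by (metis Un_subset_iff set_mset_union subset_mset.add_diff_inverse)
      then show ?thesis using f g by (simp add: power_series_def)
    next
      case False
      then show ?thesis using f g by (simp add: power_series_def)
    qed
    then have "(\<Oplus>k\<in>{k. k \<subseteq># m}. f k \<otimes> g (m - k)) = (\<Oplus>k\<in>{k. k \<subseteq># m}. \<zero>)"
      by (intro finsum_cong') auto
    then show ?thesis by simp
  qed
  moreover have "(\<Oplus>k\<in>{k. k \<subseteq># m}. f k \<otimes> g (m - k)) \<in> carrier R" for m
    using ps_coeff[OF f] ps_coeff[OF g] by (intro finsum_closed) auto
  ultimately show ?thesis by (simp add: power_series_def)
qed

lemma ps_mult_comm:
  assumes f: "f \<in> carrier (power_series R n)" and g: "g \<in> carrier (power_series R n)"
  shows "f \<otimes>\<^bsub>power_series R n\<^esub> g = g \<otimes>\<^bsub>power_series R n\<^esub> f"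
proof -
  note c = ps_coeff[OF f] ps_coeff[OF g]
  have "(\<Oplus>k\<in>{k. k \<subseteq># m}. f k \<otimes> g (m - k)) = (\<Oplus>k\<in>{k. k \<subseteq># m}. g k \<otimes> f (m - k))" for m
  proof -
    have im: "(\<lambda>k. m - k) ` {k. k \<subseteq># m} = {k. k \<subseteq># m}"
    proof (intro equalityI subsetI)
      fix k assume "k \<in> {k. k \<subseteq># m}"
      then have "k = m - (m - k)" "m - k \<in> {k. k \<subseteq># m}"
        by (simp_all add: subset_mset.diff_diff_right)
      then show "k \<in> (\<lambda>k. m - k) ` {k. k \<subseteq># m}" by (rule image_eqI)
    qed auto
    have inj: "inj_on (\<lambda>k. m - k) {k. k \<subseteq># m}"
      by (rule inj_onI) (metis mem_Collect_eq subset_mset.diff_add subset_mset.add_diff_inverse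
          add_left_cancel diff_subset_eq_self)
    have "(\<Oplus>k\<in>{k. k \<subseteq># m}. f k \<otimes> g (m - k)) =
        (\<Oplus>k\<in>(\<lambda>k. m - k) ` {k. k \<subseteq># m}. f k \<otimes> g (m - k))" by (simp only: im)
    also have "\<dots> = (\<Oplus>k\<in>{k. k \<subseteq># m}. f (m - k) \<otimes> g (m - (m - k)))"
      by (rule finsum_reindex) (use inj c in auto)
    also have "\<dots> = (\<Oplus>k\<in>{k. k \<subseteq># m}. g k \<otimes> f (m - k))"
      by (rule finsum_cong') (use c in \<open>auto simp: subset_mset.diff_diff_right m_comm\<close>)
    finally show ?thesis .
  qed
  then show ?thesis by (simp add: power_series_def)
qed

lemma ps_mult_assoc:
  assumes f: "f \<in> carrier (power_series R n)" and g: "g \<in> carrier (power_series R n)"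
    and h: "h \<in> carrier (power_series R n)"
  shows "(f \<otimes>\<^bsub>power_series R n\<^esub> g) \<otimes>\<^bsub>power_series R n\<^esub> h =
    f \<otimes>\<^bsub>power_series R n\<^esub> (g \<otimes>\<^bsub>power_series R n\<^esub> h)"
proof -
  note c [simp] = ps_coeff[OF f] ps_coeff[OF g] ps_coeff[OF h]
  let ?S = "\<lambda>m::nat multiset. {k. k \<subseteq># m}"
  have "(\<Oplus>k\<in>?S m. (\<Oplus>l\<in>?S k. f l \<otimes> g (k - l)) \<otimes> h (m - k)) =
      (\<Oplus>l\<in>?S m. f l \<otimes> (\<Oplus>j\<in>?S (m - l). g j \<otimes> h (m - l - j)))" for m
  proof -
    have "(\<Oplus>k\<in>?S m. (\<Oplus>l\<in>?S k. f l \<otimes> g (k - l)) \<otimes> h (m - k)) =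
        (\<Oplus>k\<in>?S m. \<Oplus>l\<in>?S k. f l \<otimes> g (k - l) \<otimes> h (m - k))"
      by (intro finsum_cong' finsum_ldistr finite_submultisets) (auto intro!: finsum_closed)
    also have "\<dots> = (\<Oplus>p\<in>Sigma (?S m) ?S. f (snd p) \<otimes> g (fst p - snd p) \<otimes> h (m - fst p))"
      by (rule finsum_Sigma) (auto simp: finite_submultisets)
    also have "Sigma (?S m) ?S = (\<lambda>(l, j). (l + j, l)) ` Sigma (?S m) (\<lambda>l. ?S (m - l))"
    proof (intro equalityI subsetI)
      fix p assume "p \<in> Sigma (?S m) ?S"
      then obtain k l where p: "p = (k, l)" "k \<subseteq># m" "l \<subseteq># k" by auto
      then have "p = (\<lambda>(l, j). (l + j, l)) (l, k - l)" by simp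
      moreover have "(l, k - l) \<in> Sigma (?S m) (\<lambda>l. ?S (m - l))"
        using p by (auto intro: subset_mset.order_trans simp: subset_eq_diff_conv)
      ultimately show "p \<in> (\<lambda>(l, j). (l + j, l)) ` Sigma (?S m) (\<lambda>l. ?S (m - l))" by (rule image_eqI)
    next
      fix p assume "p \<in> (\<lambda>(l, j). (l + j, l)) ` Sigma (?S m) (\<lambda>l. ?S (m - l))"
      then obtain l j where p: "p = (l + j, l)" "l \<subseteq># m" "j \<subseteq># m - l" by auto
      then have "l + j \<subseteq># m" by (metis subset_mset.le_diff_conv2 add.commute)
      then show "p \<in> Sigma (?S m) ?S" using p by auto
    qed
    also have "(\<Oplus>p\<in>(\<lambda>(l, j). (l + j, l)) ` Sigma (?S m) (\<lambda>l. ?S (m - l)).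
          f (snd p) \<otimes> g (fst p - snd p) \<otimes> h (m - fst p)) =
        (\<Oplus>p\<in>Sigma (?S m) (\<lambda>l. ?S (m - l)). f (fst p) \<otimes> (g (snd p) \<otimes> h (m - fst p - snd p)))"
      by (subst finsum_reindex)
        (auto intro!: finsum_cong' simp: inj_on_def m_assoc split_beta diff_diff_add)
    also have "\<dots> = (\<Oplus>l\<in>?S m. \<Oplus>j\<in>?S (m - l). f l \<otimes> (g j \<otimes> h (m - l - j)))"
      by (rule finsum_Sigma[symmetric]) (auto simp: finite_submultisets)
    also have "\<dots> = (\<Oplus>l\<in>?S m. f l \<otimes> (\<Oplus>j\<in>?S (m - l). g j \<otimes> h (m - l - j)))"
      by (intro finsum_cong' finsum_rdistr[symmetric] finite_submultisets) (auto intro!: finsum_closed)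
    finally show ?thesis .
  qed
  then show ?thesis by (simp add: power_series_def)
qed

lemma ps_l_one:
  assumes f: "f \<in> carrier (power_series R n)"
  shows "\<one>\<^bsub>power_series R n\<^esub> \<otimes>\<^bsub>power_series R n\<^esub> f = f"
proof -
  note [simp] = ps_coeff[OF f]
  have "(\<Oplus>k\<in>{k. k \<subseteq># m}. (if k = {#} then \<one> else \<zero>) \<otimes> f (m - k)) = f m" for m
  proof -
    have "(\<Oplus>k\<in>{k. k \<subseteq># m}. (if k = {#} then \<one> else \<zero>) \<otimes> f (m - k)) =
        (\<Oplus>k\<in>{k. k \<subseteq># m}. if {#} = k then f (m - k) else \<zero>)"
      by (rule finsum_cong') auto
    also have "\<dots> = f (m - {#})"
      by (rule finsum_singleton) (auto simp: finite_submultisets)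
    finally show ?thesis by simp
  qed
  then show ?thesis by (simp add: power_series_def)
qed

lemma ps_l_distr:
  assumes f: "f \<in> carrier (power_series R n)" and g: "g \<in> carrier (power_series R n)"
    and h: "h \<in> carrier (power_series R n)"
  shows "(f \<oplus>\<^bsub>power_series R n\<^esub> g) \<otimes>\<^bsub>power_series R n\<^esub> h =
    f \<otimes>\<^bsub>power_series R n\<^esub> h \<oplus>\<^bsub>power_series R n\<^esub> g \<otimes>\<^bsub>power_series R n\<^esub> h"
proof -
  note [simp] = ps_coeff[OF f] ps_coeff[OF g] ps_coeff[OF h]
  show ?thesis
    by (auto simp: power_series_def l_distr intro!: ext finsum_addf)
qed

lemma power_series_cring: "cring (power_series R n)"
proof (rule cringI)
  show "abelian_group (power_series R n)"
  proof (rule abelian_groupI)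
    fix f assume f: "f \<in> carrier (power_series R n)"
    have "(\<lambda>m. \<ominus> f m) \<in> carrier (power_series R n)"
      "(\<lambda>m. \<ominus> f m) \<oplus>\<^bsub>power_series R n\<^esub> f = \<zero>\<^bsub>power_series R n\<^esub>"
      using f by (auto simp: power_series_def l_neg)
    then show "\<exists>g\<in>carrier (power_series R n). g \<oplus>\<^bsub>power_series R n\<^esub> f = \<zero>\<^bsub>power_series R n\<^esub>"
      by blast
  qed (auto simp: power_series_def a_ac)
  show "Group.comm_monoid (power_series R n)"
    by (rule comm_monoidI)
      (use ps_mult_closed ps_mult_assoc ps_l_one ps_mult_comm in \<open>blast | simp add: power_series_def\<close>)+
qed (rule ps_l_distr)

lemma power_series_algebra: "algebra R (power_series R n)"
proof (rule algebraI)
  fix a f g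
  assume a: "a \<in> carrier R" and f: "f \<in> carrier (power_series R n)"
    and g: "g \<in> carrier (power_series R n)"
  show "(a \<odot>\<^bsub>power_series R n\<^esub> f) \<otimes>\<^bsub>power_series R n\<^esub> g =
      a \<odot>\<^bsub>power_series R n\<^esub> (f \<otimes>\<^bsub>power_series R n\<^esub> g)"
    using a ps_coeff[OF f] ps_coeff[OF g]
    by (auto simp: power_series_def finsum_rdistr finite_submultisets m_assoc intro!: ext finsum_cong')
qed (auto simp: power_series_cring is_cring, auto simp: power_series_def l_distr r_distr m_assoc)

end

lemma (in ring) commutator_simps:
  assumes "x \<in> carrier R" "y \<in> carrier R" "z \<in> carrier R"
  shows "x \<otimes> (\<ominus> y) \<ominus> (\<ominus> y) \<otimes> x = \<ominus> (x \<otimes> y \<ominus> y \<otimes> x)"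
    and "x \<otimes> (y \<oplus> z) \<ominus> (y \<oplus> z) \<otimes> x = (x \<otimes> y \<ominus> y \<otimes> x) \<oplus> (x \<otimes> z \<ominus> z \<otimes> x)"
    and "x \<otimes> (y \<otimes> z) \<ominus> (y \<otimes> z) \<otimes> x =
      (x \<otimes> y \<ominus> y \<otimes> x) \<otimes> z \<oplus> y \<otimes> (x \<otimes> z \<ominus> z \<otimes> x)"
  using assms by algebra+

context algebra
begin

lemma endo_ring_ring: "ring (endo_ring R M)"
proof (rule ringI)
  show "abelian_group (endo_ring R M)"
  proof (rule abelian_groupI)
    fix f assume f: "f \<in> carrier (endo_ring R M)"
    let ?g = "\<lambda>x\<in>carrier M. \<ominus>\<^bsub>M\<^esub> f x"
    have "?g \<in> carrier (endo_ring R M)" "?g \<oplus>\<^bsub>endo_ring R M\<^esub> f = \<zero>\<^bsub>endo_ring R M\<^esub>"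
      using f by (auto simp: endo_ring_def mod_hom_def Pi_iff M.minus_add smult_r_minus M.l_neg
          intro!: restrict_ext)
    then show "\<exists>g\<in>carrier (endo_ring R M). g \<oplus>\<^bsub>endo_ring R M\<^esub> f = \<zero>\<^bsub>endo_ring R M\<^esub>" by blast
  qed (auto simp: endo_ring_def mod_hom_def Pi_iff M.a_ac smult_r_distr extensional_def fun_eq_iff)
  show "Group.monoid (endo_ring R M)"
    by (rule monoidI) (auto simp: endo_ring_def mod_hom_def Pi_iff compose_def extensional_def fun_eq_iff)
qed (auto simp: endo_ring_def mod_hom_def Pi_iff compose_def extensional_def fun_eq_iff)


lemma mult_op_endo: "b \<in> carrier M \<Longrightarrow> mult_op M b \<in> carrier (endo_ring R M)"
  using smult_assoc2 by (auto simp: endo_ring_def mod_hom_def mult_op_def r_distr m_comm)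

lemma diff_ops_le_endo: "\<theta> \<in> diff_ops_le R M k \<Longrightarrow> \<theta> \<in> carrier (endo_ring R M)"
  by (induction k) (unfold diff_ops_le.simps, blast+)

lemma diff_ops_le_0_iff:
  "\<theta> \<in> diff_ops_le R M 0 \<longleftrightarrow> (\<exists>b\<in>carrier M. \<theta> = mult_op M b)"
proof
  assume \<theta>: "\<theta> \<in> diff_ops_le R M 0"
  then have "\<theta> \<in> carrier (endo_ring R M)" by (rule diff_ops_le_endo)
  then have "\<theta> \<in> carrier M \<rightarrow> carrier M" and e: "\<theta> \<in> extensional (carrier M)"
    unfolding endo_ring_def mod_hom_def by simp_all
  then have c: "\<theta> \<one>\<^bsub>M\<^esub> \<in> carrier M" using one_closed by blast
  have m: "\<theta> x = mult_op M (\<theta> \<one>\<^bsub>M\<^esub>) x" if x: "x \<in> carrier M" for x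
  proof -
    have "\<theta> (x \<otimes>\<^bsub>M\<^esub> \<one>\<^bsub>M\<^esub>) = x \<otimes>\<^bsub>M\<^esub> \<theta> \<one>\<^bsub>M\<^esub>"
      using \<theta> x one_closed unfolding diff_ops_le.simps by blast
    moreover have "mult_op M (\<theta> \<one>\<^bsub>M\<^esub>) x = \<theta> \<one>\<^bsub>M\<^esub> \<otimes>\<^bsub>M\<^esub> x"
      unfolding mult_op_def by (rule restrict_apply'[OF x])
    ultimately show ?thesis using m_comm[OF x c] r_one[OF x] by argo
  qed
  have "mult_op M (\<theta> \<one>\<^bsub>M\<^esub>) \<in> extensional (carrier M)" by (simp add: mult_op_def)
  then have "\<theta> = mult_op M (\<theta> \<one>\<^bsub>M\<^esub>)" by (rule extensionalityI[OF e _ m])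
  with c show "\<exists>b\<in>carrier M. \<theta> = mult_op M b" by blast
next
  assume "\<exists>b\<in>carrier M. \<theta> = mult_op M b"
  then obtain b where b: "b \<in> carrier M" "\<theta> = mult_op M b" by blast
  have "\<theta> (c \<otimes>\<^bsub>M\<^esub> x) = c \<otimes>\<^bsub>M\<^esub> \<theta> x" if "c \<in> carrier M" "x \<in> carrier M" for c x
    using m_lcomm[OF b(1) that] that b by (simp add: mult_op_def)
  then show "\<theta> \<in> diff_ops_le R M 0"
    using mult_op_endo[OF b(1)] b(2) unfolding diff_ops_le.simps by blast
qed

lemma diff_ops_le_closed:
  shows "b \<in> carrier M \<Longrightarrow> mult_op M b \<in> diff_ops_le R M k"
    and "\<zero>\<^bsub>endo_ring R M\<^esub> \<in> diff_ops_le R M k"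
    and "\<theta> \<in> diff_ops_le R M k \<Longrightarrow> \<ominus>\<^bsub>endo_ring R M\<^esub> \<theta> \<in> diff_ops_le R M k"
    and "\<theta> \<in> diff_ops_le R M k \<Longrightarrow> \<phi> \<in> diff_ops_le R M k \<Longrightarrow>
      \<theta> \<oplus>\<^bsub>endo_ring R M\<^esub> \<phi> \<in> diff_ops_le R M k"
proof -
  let ?E = "endo_ring R M"
  interpret E: ring ?E by (rule endo_ring_ring)
  have z0: "\<zero>\<^bsub>?E\<^esub> \<in> diff_ops_le R M 0"
    using E.zero_closed by (auto simp: endo_ring_def)
  have add0: "\<theta> \<oplus>\<^bsub>?E\<^esub> \<phi> \<in> diff_ops_le R M 0"
    if "\<theta> \<in> diff_ops_le R M 0" "\<phi> \<in> diff_ops_le R M 0" for \<theta> \<phi>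
    using that E.a_closed[of \<theta> \<phi>] by (auto simp: endo_ring_def mod_hom_def r_distr Pi_iff)
  have neg0: "\<ominus>\<^bsub>?E\<^esub> \<theta> \<in> diff_ops_le R M 0" if t: "\<theta> \<in> diff_ops_le R M 0" for \<theta>
  proof -
    obtain b where b: "b \<in> carrier M" "\<theta> = mult_op M b" using t diff_ops_le_0_iff by blast
    have "mult_op M (\<ominus>\<^bsub>M\<^esub> b) \<oplus>\<^bsub>?E\<^esub> \<theta> = \<zero>\<^bsub>?E\<^esub>"
      using b by (auto simp: endo_ring_def mult_op_def l_minus M.l_neg intro!: restrict_ext)
    then have "\<ominus>\<^bsub>?E\<^esub> \<theta> = mult_op M (\<ominus>\<^bsub>M\<^esub> b)"
      using E.minus_equality mult_op_endo b by (metis M.a_inv_closed)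
    then show ?thesis using diff_ops_le_0_iff b by blast
  qed
  have comm: "mult_op M b \<otimes>\<^bsub>?E\<^esub> mult_op M c = mult_op M c \<otimes>\<^bsub>?E\<^esub> mult_op M b"
    if "b \<in> carrier M" "c \<in> carrier M" for b c
    using that by (auto simp: endo_ring_def mult_op_def compose_def m_lcomm intro!: restrict_ext)
  have A: "\<zero>\<^bsub>?E\<^esub> \<in> diff_ops_le R M k \<and>
      (\<forall>\<theta>\<in>diff_ops_le R M k. \<ominus>\<^bsub>?E\<^esub> \<theta> \<in> diff_ops_le R M k) \<and>
      (\<forall>\<theta>\<in>diff_ops_le R M k. \<forall>\<phi>\<in>diff_ops_le R M k. \<theta> \<oplus>\<^bsub>?E\<^esub> \<phi> \<in> diff_ops_le R M k)" for k
  proof (induction k)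
    case 0
    then show ?case using z0 add0 neg0 by blast
  next
    case (Suc k)
    let ?c = "\<lambda>b \<theta>. mult_op M b \<otimes>\<^bsub>?E\<^esub> \<theta> \<ominus>\<^bsub>?E\<^esub> \<theta> \<otimes>\<^bsub>?E\<^esub> mult_op M b"
    have 1: "?c b \<zero>\<^bsub>?E\<^esub> = \<zero>\<^bsub>?E\<^esub>" if "b \<in> carrier M" for b
      using mult_op_endo[OF that] by (simp add: E.minus_eq)
    have 2: "?c b (\<ominus>\<^bsub>?E\<^esub> \<theta>) = \<ominus>\<^bsub>?E\<^esub> ?c b \<theta>"
      if "b \<in> carrier M" "\<theta> \<in> carrier ?E" for b \<theta>
      using E.commutator_simps(1) mult_op_endo[OF that(1)] that(2) by blast
    have 3: "?c b (\<theta> \<oplus>\<^bsub>?E\<^esub> \<phi>) = ?c b \<theta> \<oplus>\<^bsub>?E\<^esub> ?c b \<phi>"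
      if "b \<in> carrier M" "\<theta> \<in> carrier ?E" "\<phi> \<in> carrier ?E" for b \<theta> \<phi>
      using E.commutator_simps(2) mult_op_endo[OF that(1)] that(2,3) by blast
    show ?case using Suc.IH 1 2 3 by auto
  qed
  show "\<zero>\<^bsub>?E\<^esub> \<in> diff_ops_le R M k"
    and "\<theta> \<in> diff_ops_le R M k \<Longrightarrow> \<ominus>\<^bsub>?E\<^esub> \<theta> \<in> diff_ops_le R M k"
    and "\<theta> \<in> diff_ops_le R M k \<Longrightarrow> \<phi> \<in> diff_ops_le R M k \<Longrightarrow> \<theta> \<oplus>\<^bsub>?E\<^esub> \<phi> \<in> diff_ops_le R M k"
    using A by blast+
  assume b: "b \<in> carrier M"
  show "mult_op M b \<in> diff_ops_le R M k"
  proof (cases k)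
    case 0
    then show ?thesis using b diff_ops_le_0_iff by blast
  next
    case (Suc j)
    have "mult_op M c \<otimes>\<^bsub>?E\<^esub> mult_op M b \<ominus>\<^bsub>?E\<^esub> mult_op M b \<otimes>\<^bsub>?E\<^esub> mult_op M c = \<zero>\<^bsub>?E\<^esub>"
      if "c \<in> carrier M" for c
      using comm[OF that b] mult_op_endo[OF that] mult_op_endo[OF b] by (simp add: E.minus_eq E.r_neg)
    then show ?thesis using Suc mult_op_endo[OF b] A by simp
  qed
qed

declare diff_ops_le.simps [simp del]

lemma diff_ops_le_SucI:
  assumes "\<theta> \<in> carrier (endo_ring R M)"
    and "\<And>b. b \<in> carrier M \<Longrightarrow> mult_op M b \<otimes>\<^bsub>endo_ring R M\<^esub> \<theta>
      \<ominus>\<^bsub>endo_ring R M\<^esub> \<theta> \<otimes>\<^bsub>endo_ring R M\<^esub> mult_op M b \<in> diff_ops_le R M k"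
  shows "\<theta> \<in> diff_ops_le R M (Suc k)"
  using assms unfolding diff_ops_le.simps(2) by blast

lemma diff_ops_le_SucD:
  assumes "\<theta> \<in> diff_ops_le R M (Suc k)" "b \<in> carrier M"
  shows "mult_op M b \<otimes>\<^bsub>endo_ring R M\<^esub> \<theta>
      \<ominus>\<^bsub>endo_ring R M\<^esub> \<theta> \<otimes>\<^bsub>endo_ring R M\<^esub> mult_op M b \<in> diff_ops_le R M k"
  using assms unfolding diff_ops_le.simps(2) by blast

lemma diff_ops_le_Suc: "\<theta> \<in> diff_ops_le R M k \<Longrightarrow> \<theta> \<in> diff_ops_le R M (Suc k)"
proof (induction k arbitrary: \<theta>)
  case 0
  then obtain b where "b \<in> carrier M" "\<theta> = mult_op M b"
    unfolding diff_ops_le_0_iff by blast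
  then show ?case using diff_ops_le_closed(1)[of b] by simp
next
  case (Suc k)
  show ?case
  proof (rule diff_ops_le_SucI)
    show "\<theta> \<in> carrier (endo_ring R M)" using Suc.prems by (rule diff_ops_le_endo)
    fix b assume "b \<in> carrier M"
    then show "mult_op M b \<otimes>\<^bsub>endo_ring R M\<^esub> \<theta> \<ominus>\<^bsub>endo_ring R M\<^esub> \<theta> \<otimes>\<^bsub>endo_ring R M\<^esub> mult_op M b
        \<in> diff_ops_le R M (Suc k)"
      by (intro Suc.IH diff_ops_le_SucD[OF Suc.prems])
  qed
qed

lemma diff_ops_le_mono:
  assumes "k \<le> l" "\<theta> \<in> diff_ops_le R M k" shows "\<theta> \<in> diff_ops_le R M l"
  using assms by (induction l rule: dec_induct) (auto intro: diff_ops_le_Suc simp del: diff_ops_le.simps)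

lemma diff_ops_le_mult:
  assumes "\<theta> \<in> diff_ops_le R M k" "\<phi> \<in> diff_ops_le R M l"
  shows "\<theta> \<otimes>\<^bsub>endo_ring R M\<^esub> \<phi> \<in> diff_ops_le R M (k + l)"
  using assms
proof (induction "k + l" arbitrary: k l \<theta> \<phi>)
  case 0
  then have "k = 0" "l = 0" by simp_all
  then have "\<theta> \<in> diff_ops_le R M 0" "\<phi> \<in> diff_ops_le R M 0" using 0(2,3) by simp_all
  then obtain b c where b: "b \<in> carrier M" "\<theta> = mult_op M b"
    and c: "c \<in> carrier M" "\<phi> = mult_op M c"
    unfolding diff_ops_le_0_iff by blast
  have "mult_op M b \<otimes>\<^bsub>endo_ring R M\<^esub> mult_op M c = mult_op M (b \<otimes>\<^bsub>M\<^esub> c)"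
    using b(1) c(1) by (auto simp: endo_ring_def mult_op_def compose_def m_assoc intro!: restrict_ext)
  then show ?case using diff_ops_le_closed(1)[OF m_closed[OF b(1) c(1)]] b(2) c(2) by simp
next
  case (Suc s)
  let ?E = "endo_ring R M"
  interpret E: ring ?E by (rule endo_ring_ring)
  let ?c = "\<lambda>b \<theta>. mult_op M b \<otimes>\<^bsub>?E\<^esub> \<theta> \<ominus>\<^bsub>?E\<^esub> \<theta> \<otimes>\<^bsub>?E\<^esub> mult_op M b"
  note e = diff_ops_le_endo[OF Suc.prems(1)] diff_ops_le_endo[OF Suc.prems(2)]
  have c0: "?c b \<psi> = \<zero>\<^bsub>?E\<^esub>" if b: "b \<in> carrier M" and p: "\<psi> \<in> diff_ops_le R M 0" for b \<psi>
  proof -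
    obtain c where c: "c \<in> carrier M" "\<psi> = mult_op M c"
      using p unfolding diff_ops_le_0_iff by blast
    have "mult_op M b \<otimes>\<^bsub>?E\<^esub> \<psi> = \<psi> \<otimes>\<^bsub>?E\<^esub> mult_op M b"
      using b c(1) unfolding c(2)
      by (auto simp: endo_ring_def mult_op_def compose_def m_lcomm intro!: restrict_ext)
    moreover have "\<psi> \<otimes>\<^bsub>?E\<^esub> mult_op M b \<in> carrier ?E"
      by (intro E.m_closed diff_ops_le_endo[OF p] mult_op_endo b)
    ultimately show ?thesis unfolding E.minus_eq by (simp only: E.r_neg)
  qed
  have "?c b (\<theta> \<otimes>\<^bsub>?E\<^esub> \<phi>) \<in> diff_ops_le R M s" if b: "b \<in> carrier M" for b
  proof -
    have eq: "?c b (\<theta> \<otimes>\<^bsub>?E\<^esub> \<phi>) = ?c b \<theta> \<otimes>\<^bsub>?E\<^esub> \<phi> \<oplus>\<^bsub>?E\<^esub> \<theta> \<otimes>\<^bsub>?E\<^esub> ?c b \<phi>"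
      by (rule E.commutator_simps(3)[OF mult_op_endo[OF b] e])
    have 1: "?c b \<theta> \<otimes>\<^bsub>?E\<^esub> \<phi> \<in> diff_ops_le R M s"
    proof (cases k)
      case 0
      have "?c b \<theta> = \<zero>\<^bsub>?E\<^esub>" using c0[OF b] Suc.prems(1) unfolding 0 .
      then show ?thesis using diff_ops_le_closed(2) E.l_null[OF e(2)] by presburger
    next
      case k: (Suc j)
      then have "?c b \<theta> \<in> diff_ops_le R M j"
        using diff_ops_le_SucD Suc.prems(1) b by blast
      moreover have "s = j + l" using Suc.hyps(2) k by simp
      ultimately show ?thesis using Suc.hyps(1)[OF _ _ Suc.prems(2)] by blast
    qed
    have 2: "\<theta> \<otimes>\<^bsub>?E\<^esub> ?c b \<phi> \<in> diff_ops_le R M s"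
    proof (cases l)
      case 0
      have "?c b \<phi> = \<zero>\<^bsub>?E\<^esub>" using c0[OF b] Suc.prems(2) unfolding 0 .
      then show ?thesis using diff_ops_le_closed(2) E.r_null[OF e(1)] by presburger
    next
      case l: (Suc j)
      then have "?c b \<phi> \<in> diff_ops_le R M j"
        using diff_ops_le_SucD Suc.prems(2) b by blast
      moreover have "s = k + j" using Suc.hyps(2) l by simp
      ultimately show ?thesis using Suc.hyps(1)[OF _ Suc.prems(1)] by blast
    qed
    show ?thesis unfolding eq by (rule diff_ops_le_closed(4)[OF 1 2])
  qed
  then have "\<theta> \<otimes>\<^bsub>?E\<^esub> \<phi> \<in> diff_ops_le R M (Suc s)"
    by (rule diff_ops_le_SucI[OF E.m_closed[OF e]])
  then show ?case unfolding Suc.hyps(2) .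
qed

lemma diff_ops_subring: "subring (carrier (diff_ops R M)) (endo_ring R M)"
proof (rule ring.subringI[OF endo_ring_ring])
  have "\<one>\<^bsub>endo_ring R M\<^esub> = mult_op M \<one>\<^bsub>M\<^esub>"
    by (auto simp: endo_ring_def mult_op_def)
  then show "\<one>\<^bsub>endo_ring R M\<^esub> \<in> carrier (diff_ops R M)"
    using diff_ops_le_closed(1)[of "\<one>\<^bsub>M\<^esub>" 0] by (auto simp: diff_ops_def simp del: diff_ops_le.simps)
next
  fix \<theta> \<phi> assume a: "\<theta> \<in> carrier (diff_ops R M)" "\<phi> \<in> carrier (diff_ops R M)"
  then obtain k l where kl: "\<theta> \<in> diff_ops_le R M k" "\<phi> \<in> diff_ops_le R M l"
    by (auto simp: diff_ops_def)
  show "\<theta> \<otimes>\<^bsub>endo_ring R M\<^esub> \<phi> \<in> carrier (diff_ops R M)"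
    using diff_ops_le_mult[OF kl] by (auto simp: diff_ops_def)
  show "\<theta> \<oplus>\<^bsub>endo_ring R M\<^esub> \<phi> \<in> carrier (diff_ops R M)"
    using diff_ops_le_closed(4)[of \<theta> "max k l" \<phi>] diff_ops_le_mono[OF _ kl(1), of "max k l"]
      diff_ops_le_mono[OF _ kl(2), of "max k l"] by (auto simp: diff_ops_def)
qed (auto simp: diff_ops_def dest: diff_ops_le_endo diff_ops_le_closed(3))

lemma diff_ops_ring: "ring (diff_ops R M)"
  using ring.subring_is_ring[OF endo_ring_ring diff_ops_subring] by (simp add: diff_ops_def)

end

end

theory Submission
  imports Defs
begin

text \<open>Lift a basis of \<open>M / \<bb> M\<close> to a family \<open>J\<close> in \<open>M\<close>, let \<open>F\<close> be the free \<open>B\<close>-module on \<open>J\<close> and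
  \<open>\<Phi> : F \<rightarrow> M\<close> the evaluation map. Since \<open>M = \<Phi>(F) + \<bb> M\<close>, also \<open>M = \<Phi>(F) + \<bb>\<^sup>k M\<close> for all
  \<open>k\<close>. Conversely \<open>\<Phi>(f) \<in> \<bb>\<^sup>k M\<close> forces \<open>f \<in> \<bb>\<^sup>k F\<close>: the partial derivatives act on \<open>M\<close> by the
  Leibniz rule and lower the \<open>\<bb>\<close>-adic filtration by one, and over \<open>\<rat>\<close> a power series without
  constant term all of whose partial derivatives lie in \<open>\<bb>\<^sup>k\<close> itself lies in \<open>\<bb>\<^bsup>k+1\<^esup>\<close>. Hence
  \<open>\<Phi>\<close> induces isomorphisms \<open>F / \<bb>\<^sup>k F \<cong> M / \<bb>\<^sup>k M\<close>, and \<open>M\<close> is the completion of \<open>F\<close>.\<close>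

section \<open>Adic filtrations and completion\<close>

text \<open>Completeness and freeness modulo \<bb> do not suffice by themselves: for n > 0 the
  B-module B / \<bb> = A is complete and free of rank one modulo \<bb>, yet the variables kill it,
  so it is not adically free. The derivations exclude such torsion. Surjectivity modulo \<bb>^k is a
  matter of generators alone; the derivations work in the proof of injectivity. There, freeness
  modulo \<bb> only gives the case k = 1, the vanishing of constant terms, and differentiation
  carries this one degree further at a time. The integers that it produces have to be cancelled,
  hence the rationals. As the rank may be infinite, everything is done with finite linear
  combinations and quotients; completeness enters only at the end, when M is identified with the
  limit of its quotients. The criterion on derivatives concerns coefficients, while the filtration
  of M is defined by powers of an ideal. The two fit together because there are finitely many
  variables, so that \<bb>^k consists of all series without terms of degree below k.\<close>

context abelian_group_hom
begin

text \<open>Provides the subgroup handed to \<open>ideal_smult_least\<close> when a map is shown to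
  respect adic filtrations.\<close>

lemma vimage_additive_subgroup:
  assumes "additive_subgroup S H" shows "additive_subgroup {x \<in> carrier G. h x \<in> S} G"
proof (rule additive_subgroup.intro, rule G.add.subgroupI)
  interpret S: additive_subgroup S H by fact
  show "{x \<in> carrier G. h x \<in> S} \<noteq> {}"
    using S.zero_closed by (auto intro!: exI[of _ "\<zero>\<^bsub>G\<^esub>"])
  fix x assume "x \<in> {x \<in> carrier G. h x \<in> S}"
  then show "\<ominus>\<^bsub>G\<^esub> x \<in> {x \<in> carrier G. h x \<in> S}"
    using S.a_inv_closed by auto
qed (use additive_subgroup.a_closed[OF assms] in auto)

text \<open>For infinite \<open>S\<close> both sums take the default value zero, which
  \<open>h\<close> preserves.\<close>

lemma hom_finsum:
  assumes "f \<in> S \<rightarrow> carrier G"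
  shows "h (\<Oplus>\<^bsub>G\<^esub>i\<in>S. f i) = (\<Oplus>\<^bsub>H\<^esub>i\<in>S. h (f i))"
  using assms by (induction S rule: infinite_finite_induct) (auto simp: Pi_iff)

lemma hom_minus:
  "x \<in> carrier G \<Longrightarrow> y \<in> carrier G \<Longrightarrow> h (x \<ominus>\<^bsub>G\<^esub> y) = h x \<ominus>\<^bsub>H\<^esub> h y"
  by (simp add: G.minus_eq H.minus_eq)

end

lemma abelian_group_homI':
  assumes "abelian_group G" "abelian_group H" "h \<in> carrier G \<rightarrow> carrier H"
    and "\<And>x y. x \<in> carrier G \<Longrightarrow> y \<in> carrier G \<Longrightarrow> h (x \<oplus>\<^bsub>G\<^esub> y) = h x \<oplus>\<^bsub>H\<^esub> h y"
  shows "abelian_group_hom G H h"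
  using assms
  by (auto intro!: abelian_group_homI group_hom.intro group_hom_axioms.intro
      simp: hom_def abelian_group.a_group)

lemma mod_hom_abelian_group_hom:
  assumes F: "module R F" and N: "module R N" and h: "h \<in> mod_hom R F N"
  shows "abelian_group_hom F N h"
  by (rule abelian_group_homI') (use h module.axioms(2)[OF F] module.axioms(2)[OF N] in \<open>auto simp: mod_hom_def\<close>)

lemma mod_hom_smult:
  "h \<in> mod_hom R F N \<Longrightarrow> r \<in> carrier R \<Longrightarrow> x \<in> carrier F \<Longrightarrow> h (r \<odot>\<^bsub>F\<^esub> x) = r \<odot>\<^bsub>N\<^esub> h x"
  by (simp add: mod_hom_def)

text \<open>The transition maps of the inverse limit are encoded as adding the larger subgroup to a
  coset of the smaller one; this evaluates them on representatives.\<close>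

lemma (in abelian_group) set_add_coset_absorb:
  assumes S: "additive_subgroup S G" and T: "additive_subgroup T G" and sub: "T \<subseteq> S"
    and x: "x \<in> carrier G"
  shows "S <+> (T +> x) = S +> x"
proof -
  interpret S: additive_subgroup S G by fact
  interpret T: additive_subgroup T G by fact
  have "S <+> T = S"
  proof
    show "S <+> T \<subseteq> S" using sub S.a_closed by (auto simp: set_add_def')
    show "S \<subseteq> S <+> T"
    proof
      fix s assume s: "s \<in> S"
      then have "s = s \<oplus> \<zero>" using S.a_subset by auto
      then show "s \<in> S <+> T" using s T.zero_closed unfolding set_add_def' by blast
    qed
  qed
  then show ?thesis using a_setmult_rcos_assoc[OF S.a_subset T.a_subset x] by simp
qed

section \<open>Powers of an ideal and the adic filtration of a module\<close>

context module
begin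

lemma submodule_abelian_subgroup:
  assumes "submodule N R M" shows "abelian_subgroup N M"
  by (rule abelian_subgroupI3[OF additive_subgroup.intro[OF submodule.axioms(1)[OF assms]]
        M.abelian_group_axioms])

text \<open>\<open>ideal_smult\<close> is generated as an additive group only. Scalars preserve it
  because \<open>I\<close> absorbs multiplication, so that generators go to generators.\<close>

lemma ideal_smult_submodule:
  assumes "ideal I R" shows "submodule (ideal_smult M I) R M"
proof -
  interpret I: ideal I R by fact
  let ?G = "{r \<odot>\<^bsub>M\<^esub> x | r x. r \<in> I \<and> x \<in> carrier M}"
  have G: "?G \<subseteq> carrier M" by auto
  have sub: "subgroup (ideal_smult M I) (add_monoid M)"
    unfolding ideal_smult_def by (rule M.add.generate_is_subgroup[OF G])
  have "a \<odot>\<^bsub>M\<^esub> x \<in> ideal_smult M I" if a: "a \<in> carrier R" and x: "x \<in> ideal_smult M I" for a x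
    using x unfolding ideal_smult_def
  proof (induction rule: generate.induct)
    case one
    show ?case using a generate.one[of "add_monoid M"] by simp
  next
    case (incl y)
    then obtain r z where y: "y = r \<odot>\<^bsub>M\<^esub> z" "r \<in> I" "z \<in> carrier M" by blast
    then have "a \<odot>\<^bsub>M\<^esub> y = (a \<otimes> r) \<odot>\<^bsub>M\<^esub> z" using a by (simp add: smult_assoc1)
    then show ?case using y a I.I_l_closed by (blast intro: generate.incl)
  next
    case (inv y)
    then obtain r z where y: "y = r \<odot>\<^bsub>M\<^esub> z" "r \<in> I" "z \<in> carrier M" by blast
    then have "a \<odot>\<^bsub>M\<^esub> (\<ominus>\<^bsub>M\<^esub> y) = \<ominus>\<^bsub>M\<^esub> ((a \<otimes> r) \<odot>\<^bsub>M\<^esub> z)"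
      using a by (simp add: smult_assoc1 smult_r_minus)
    then have "a \<odot>\<^bsub>M\<^esub> inv\<^bsub>add_monoid M\<^esub> y = inv\<^bsub>add_monoid M\<^esub> ((a \<otimes> r) \<odot>\<^bsub>M\<^esub> z)"
      by (simp add: a_inv_def)
    then show ?case using y a I.I_l_closed generate.inv[of "(a \<otimes> r) \<odot>\<^bsub>M\<^esub> z" ?G "add_monoid M"]
      by auto
  next
    case (eng y z)
    have "y \<in> carrier M" "z \<in> carrier M"
      using eng.hyps subgroup.subset[OF sub] unfolding ideal_smult_def by auto
    then show ?case using eng.IH a generate.eng by (fastforce simp: smult_r_distr)
  qed
  then show ?thesis using sub by (auto intro!: submodule.intro submodule_axioms.intro)
qed

lemma ideal_smult_incl:
  "r \<in> I \<Longrightarrow> x \<in> carrier M \<Longrightarrow> r \<odot>\<^bsub>M\<^esub> x \<in> ideal_smult M I"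
  unfolding ideal_smult_def by (blast intro: generate.incl)

text \<open>\<open>N\<close> is only asked to be an additive subgroup: it will also be a preimage
  under a derivation, which is not linear over the power series.\<close>

lemma ideal_smult_least:
  assumes "additive_subgroup N M" "\<And>r x. r \<in> I \<Longrightarrow> x \<in> carrier M \<Longrightarrow> r \<odot>\<^bsub>M\<^esub> x \<in> N"
  shows "ideal_smult M I \<subseteq> N"
  unfolding ideal_smult_def
  by (rule M.add.generate_subgroup_incl) (use assms additive_subgroup.a_subgroup in auto)

lemma ideal_pow_ideal:
  assumes "ideal I R" shows "ideal (I [^]\<^bsub>ideals_set R\<^esub> (k::nat)) R"
proof (induction k)
  case 0
  then show ?case by (simp add: nat_pow_def ideals_set_def oneideal)
next
  case (Suc k)
  then show ?case using ideal_prod_is_ideal[OF Suc assms] by (simp add: nat_pow_def ideals_set_def)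
qed

lemma ideal_pow_0: "I [^]\<^bsub>ideals_set R\<^esub> (0::nat) = carrier R"
  by (simp add: nat_pow_def ideals_set_def)

lemma ideal_pow_Suc:
  "I [^]\<^bsub>ideals_set R\<^esub> (Suc k) = (I [^]\<^bsub>ideals_set R\<^esub> k) \<cdot> I"
  by (simp add: nat_pow_def ideals_set_def)

lemma ideal_pow_antimono:
  assumes "ideal I R" "k \<le> l"
  shows "I [^]\<^bsub>ideals_set R\<^esub> l \<subseteq> I [^]\<^bsub>ideals_set R\<^esub> (k::nat)"
  using assms(2)
proof (induction l rule: dec_induct)
  case (step l)
  have "I [^]\<^bsub>ideals_set R\<^esub> Suc l \<subseteq> I [^]\<^bsub>ideals_set R\<^esub> l"
    using ideal_prod_inter[OF ideal_pow_ideal[OF assms(1)] assms(1)] unfolding ideal_pow_Suc by blast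
  then show ?case using step.IH by blast
qed simp

lemma adic_sub_submodule: "ideal I R \<Longrightarrow> submodule (adic_sub R I M k) R M"
  unfolding adic_sub_def by (intro ideal_smult_submodule ideal_pow_ideal)

lemma adic_sub_0: "adic_sub R I M 0 = carrier M"
proof
  show "adic_sub R I M 0 \<subseteq> carrier M"
    using submodule.axioms(1)[OF ideal_smult_submodule[OF oneideal]] subgroup.subset
    unfolding adic_sub_def ideal_pow_0 by fastforce
  show "carrier M \<subseteq> adic_sub R I M 0"
  proof
    fix x assume "x \<in> carrier M"
    then show "x \<in> adic_sub R I M 0"
      using ideal_smult_incl[of \<one> "carrier R" x] unfolding adic_sub_def ideal_pow_0 by simp
  qed
qed

lemma adic_sub_antimono:
  assumes "ideal I R" "k \<le> l" shows "adic_sub R I M l \<subseteq> adic_sub R I M k"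
  unfolding adic_sub_def ideal_smult_def
  by (rule M.add.mono_generate) (use ideal_pow_antimono[OF assms] in blast)

text \<open>This gains one power in the density argument: an approximation modulo
  \<open>I M\<close>, multiplied by an element of the k-th power, becomes one modulo the next
  step.\<close>

lemma adic_sub_Suc_smult:
  assumes I: "ideal I R" and r: "r \<in> I [^]\<^bsub>ideals_set R\<^esub> k" and x: "x \<in> ideal_smult M I"
  shows "r \<odot>\<^bsub>M\<^esub> x \<in> adic_sub R I M (Suc k)"
proof -
  interpret S: submodule "adic_sub R I M (Suc k)" R M by (rule adic_sub_submodule[OF I])
  have rc: "r \<in> carrier R" using ideal.Icarr[OF ideal_pow_ideal[OF I] r] .
  have "ideal_smult M I \<subseteq> {x \<in> carrier M. r \<odot>\<^bsub>M\<^esub> x \<in> adic_sub R I M (Suc k)}"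
  proof (rule ideal_smult_least)
    interpret N: abelian_subgroup "adic_sub R I M (Suc k)" M
      by (rule submodule_abelian_subgroup[OF S.submodule_axioms])
    interpret r: abelian_group_hom M M "\<lambda>x. r \<odot>\<^bsub>M\<^esub> x"
      by (rule abelian_group_homI') (use rc M.abelian_group_axioms in \<open>auto simp: smult_r_distr\<close>)
    show "additive_subgroup {x \<in> carrier M. r \<odot>\<^bsub>M\<^esub> x \<in> adic_sub R I M (Suc k)} M"
      by (rule r.vimage_additive_subgroup[OF N.additive_subgroup_axioms])
  next
    fix s y assume s: "s \<in> I" and y: "y \<in> carrier M"
    have sc: "s \<in> carrier R" using ideal.Icarr[OF I s] .
    have "(r \<otimes> s) \<odot>\<^bsub>M\<^esub> y \<in> adic_sub R I M (Suc k)"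
      unfolding adic_sub_def ideal_pow_Suc by (intro ideal_smult_incl ideal_prod.prod r s y)
    then show "s \<odot>\<^bsub>M\<^esub> y \<in> {x \<in> carrier M. r \<odot>\<^bsub>M\<^esub> x \<in> adic_sub R I M (Suc k)}"
      using rc sc y by (simp add: smult_assoc1)
  qed
  then show ?thesis using x by blast
qed

end

section \<open>Homomorphisms and adic filtrations\<close>

lemma mod_hom_adic_sub:
  assumes N: "module R N" and F: "module R F" and I: "ideal I R" and h: "h \<in> mod_hom R F N"
    and x: "x \<in> adic_sub R I F k"
  shows "h x \<in> adic_sub R I N k"
proof -
  interpret N: module R N by fact
  interpret F: module R F by fact
  interpret S: abelian_subgroup "adic_sub R I N k" N
    by (rule N.submodule_abelian_subgroup[OF N.adic_sub_submodule[OF I]])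
  interpret h: abelian_group_hom F N h by (rule mod_hom_abelian_group_hom[OF F N h])
  have "adic_sub R I F k \<subseteq> {x \<in> carrier F. h x \<in> adic_sub R I N k}"
    unfolding adic_sub_def[of R I F]
  proof (rule F.ideal_smult_least)
    show "additive_subgroup {x \<in> carrier F. h x \<in> adic_sub R I N k} F"
      by (rule h.vimage_additive_subgroup[OF S.additive_subgroup_axioms])
  next
    fix r y assume r: "r \<in> I [^]\<^bsub>ideals_set R\<^esub> k" and y: "y \<in> carrier F"
    have rc: "r \<in> carrier R" using ideal.Icarr[OF N.ideal_pow_ideal[OF I] r] .
    have "r \<odot>\<^bsub>N\<^esub> h y \<in> adic_sub R I N k"
      unfolding adic_sub_def by (intro N.ideal_smult_incl r h.hom_closed y)
    then show "r \<odot>\<^bsub>F\<^esub> y \<in> {x \<in> carrier F. h x \<in> adic_sub R I N k}"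
      using rc y mod_hom_smult[OF h] by simp
  qed
  then show ?thesis using x by blast
qed

text \<open>Successive approximation in the manner of Nakayama, without finite generation. The error
  modulo step \<open>k\<close> is a finite sum of terms \<open>r y\<close> up to sign, with
  \<open>r\<close> in the k-th power; approximating each \<open>y\<close> modulo \<open>I N\<close>
  corrects it up to step \<open>k + 1\<close>.\<close>

lemma mod_hom_adic_dense:
  assumes N: "module R N" and F: "module R F" and I: "ideal I R" and h: "h \<in> mod_hom R F N"
    and dense: "\<And>x. x \<in> carrier N \<Longrightarrow> \<exists>f\<in>carrier F. h f \<ominus>\<^bsub>N\<^esub> x \<in> ideal_smult N I"
    and x: "x \<in> carrier N"
  shows "\<exists>f\<in>carrier F. h f \<ominus>\<^bsub>N\<^esub> x \<in> adic_sub R I N k"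
proof -
  interpret N: module R N by fact
  interpret F: module R F by fact
  interpret h: abelian_group_hom F N h by (rule mod_hom_abelian_group_hom[OF F N h])
  show ?thesis
    using x
  proof (induction k arbitrary: x)
    case 0
    then show ?case by (auto simp: N.adic_sub_0 N.M.minus_eq intro!: bexI[of _ "\<zero>\<^bsub>F\<^esub>"])
  next
    case (Suc k)
    interpret S: abelian_subgroup "adic_sub R I N (Suc k)" N
      by (rule N.submodule_abelian_subgroup[OF N.adic_sub_submodule[OF I]])
    \<comment> \<open>\<open>?W\<close> collects the elements that can be approximated modulo step
      \<open>k + 1\<close>. Being an additive subgroup, it contains step \<open>k\<close> once it
      contains the generators \<open>r y\<close>.\<close>
    let ?W = "{y \<in> carrier N. \<exists>g\<in>carrier F. h g \<ominus>\<^bsub>N\<^esub> y \<in> adic_sub R I N (Suc k)}"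
    have "adic_sub R I N k \<subseteq> ?W"
      unfolding adic_sub_def[of R I N k]
    proof (rule N.ideal_smult_least)
      show "additive_subgroup ?W N"
      proof (rule additive_subgroup.intro, rule N.M.add.subgroupI)
        show "?W \<noteq> {}"
          by (auto simp: N.M.minus_eq intro!: exI[of _ "\<zero>\<^bsub>N\<^esub>"] bexI[of _ "\<zero>\<^bsub>F\<^esub>"])
      next
        fix y assume "y \<in> ?W"
        then obtain g where g: "y \<in> carrier N" "g \<in> carrier F" "h g \<ominus>\<^bsub>N\<^esub> y \<in> adic_sub R I N (Suc k)"
          by blast
        have "h (\<ominus>\<^bsub>F\<^esub> g) \<ominus>\<^bsub>N\<^esub> (\<ominus>\<^bsub>N\<^esub> y) = \<ominus>\<^bsub>N\<^esub> (h g \<ominus>\<^bsub>N\<^esub> y)"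
          using g by (simp add: N.M.minus_eq N.M.minus_add)
        then have "h (\<ominus>\<^bsub>F\<^esub> g) \<ominus>\<^bsub>N\<^esub> (\<ominus>\<^bsub>N\<^esub> y) \<in> adic_sub R I N (Suc k)"
          using S.a_inv_closed[OF g(3)] by simp
        then show "\<ominus>\<^bsub>N\<^esub> y \<in> ?W"
          using g by (auto intro!: bexI[of _ "\<ominus>\<^bsub>F\<^esub> g"])
      next
        fix y z assume "y \<in> ?W" "z \<in> ?W"
        then obtain f g where g: "y \<in> carrier N" "f \<in> carrier F" "h f \<ominus>\<^bsub>N\<^esub> y \<in> adic_sub R I N (Suc k)"
          "z \<in> carrier N" "g \<in> carrier F" "h g \<ominus>\<^bsub>N\<^esub> z \<in> adic_sub R I N (Suc k)"
          by blast
        have "h (f \<oplus>\<^bsub>F\<^esub> g) \<ominus>\<^bsub>N\<^esub> (y \<oplus>\<^bsub>N\<^esub> z) = (h f \<ominus>\<^bsub>N\<^esub> y) \<oplus>\<^bsub>N\<^esub> (h g \<ominus>\<^bsub>N\<^esub> z)"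
          using g by (simp add: N.M.minus_eq N.M.minus_add N.M.a_ac)
        then have "h (f \<oplus>\<^bsub>F\<^esub> g) \<ominus>\<^bsub>N\<^esub> (y \<oplus>\<^bsub>N\<^esub> z) \<in> adic_sub R I N (Suc k)"
          using S.a_closed[OF g(3) g(6)] by simp
        then show "y \<oplus>\<^bsub>N\<^esub> z \<in> ?W"
          using g by (auto intro!: bexI[of _ "f \<oplus>\<^bsub>F\<^esub> g"])
      qed auto
    next
      fix r y assume r: "r \<in> I [^]\<^bsub>ideals_set R\<^esub> k" and y: "y \<in> carrier N"
      have rc: "r \<in> carrier R" using ideal.Icarr[OF N.ideal_pow_ideal[OF I] r] .
      obtain g where g: "g \<in> carrier F" "h g \<ominus>\<^bsub>N\<^esub> y \<in> ideal_smult N I" using dense[OF y] by blast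
      have "h (r \<odot>\<^bsub>F\<^esub> g) \<ominus>\<^bsub>N\<^esub> (r \<odot>\<^bsub>N\<^esub> y) = r \<odot>\<^bsub>N\<^esub> (h g \<ominus>\<^bsub>N\<^esub> y)"
        using g rc y by (simp add: mod_hom_smult[OF h] N.M.minus_eq N.smult_r_distr N.smult_r_minus)
      then have "h (r \<odot>\<^bsub>F\<^esub> g) \<ominus>\<^bsub>N\<^esub> (r \<odot>\<^bsub>N\<^esub> y) \<in> adic_sub R I N (Suc k)"
        using N.adic_sub_Suc_smult[OF I r g(2)] by simp
      then show "r \<odot>\<^bsub>N\<^esub> y \<in> ?W" using g rc y by (auto intro!: bexI[of _ "r \<odot>\<^bsub>F\<^esub> g"])
    qed
    moreover obtain f where f: "f \<in> carrier F" "h f \<ominus>\<^bsub>N\<^esub> x \<in> adic_sub R I N k"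
      using Suc by blast
    ultimately obtain g where g: "g \<in> carrier F"
      "h g \<ominus>\<^bsub>N\<^esub> (h f \<ominus>\<^bsub>N\<^esub> x) \<in> adic_sub R I N (Suc k)" by blast
    \<comment> \<open>\<open>g\<close> approximates the error of \<open>f\<close>, so it is
      subtracted.\<close>
    have "h (f \<ominus>\<^bsub>F\<^esub> g) \<ominus>\<^bsub>N\<^esub> x = \<ominus>\<^bsub>N\<^esub> (h g \<ominus>\<^bsub>N\<^esub> (h f \<ominus>\<^bsub>N\<^esub> x))"
      using f g Suc.prems by (simp add: h.hom_minus N.M.minus_eq N.M.minus_add N.M.a_ac)
    then have "h (f \<ominus>\<^bsub>F\<^esub> g) \<ominus>\<^bsub>N\<^esub> x \<in> adic_sub R I N (Suc k)"
      using S.a_inv_closed[OF g(2)] by simp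
    then show ?case using f g by (auto intro!: bexI[of _ "f \<ominus>\<^bsub>F\<^esub> g"])
  qed
qed

text \<open>\<open>inj\<close> and \<open>dense\<close> make \<open>h\<close> induce bijections
  between the k-th quotients of \<open>F\<close> and \<open>N\<close>. The isomorphism is built in
  the direction from \<open>N\<close>, out of preimages of cosets, so that no quotient map has to be
  inverted.\<close>

lemma adic_completion_iso:
  assumes N: "module R N" and F: "module R F" and I: "ideal I R" and h: "h \<in> mod_hom R F N"
    and inj: "\<And>k f. f \<in> carrier F \<Longrightarrow> h f \<in> adic_sub R I N k \<Longrightarrow> f \<in> adic_sub R I F k"
    and dense: "\<And>k x. x \<in> carrier N \<Longrightarrow> \<exists>f\<in>carrier F. h f \<ominus>\<^bsub>N\<^esub> x \<in> adic_sub R I N k"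
    and complete: "adically_complete R I N"
  shows "is_mod_iso R N (adic_completion R I F)"
proof -
  interpret N: module R N by fact
  interpret F: module R F by fact
  interpret S: submodule "adic_sub R I N k" R N for k by (rule N.adic_sub_submodule[OF I])
  interpret S: abelian_subgroup "adic_sub R I N k" N for k
    by (rule N.submodule_abelian_subgroup[OF N.adic_sub_submodule[OF I]])
  interpret T: submodule "adic_sub R I F k" R F for k by (rule F.adic_sub_submodule[OF I])
  interpret T: abelian_subgroup "adic_sub R I F k" F for k
    by (rule F.submodule_abelian_subgroup[OF F.adic_sub_submodule[OF I]])
  let ?S = "adic_sub R I N" and ?T = "adic_sub R I F"
  interpret h: abelian_group_hom F N h by (rule mod_hom_abelian_group_hom[OF F N h])
  note hc = h.hom_closed and ha = h.hom_add and hd = h.hom_minus and hs = mod_hom_smult[OF h]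
  \<comment> \<open>Injectivity and well-definedness of the k-th quotient map in one equivalence:
    the former is \<open>inj\<close>, the latter holds for every homomorphism.\<close>
  have diff_in: "f \<ominus>\<^bsub>F\<^esub> g \<in> ?T k \<longleftrightarrow> h f \<ominus>\<^bsub>N\<^esub> h g \<in> ?S k"
    if "f \<in> carrier F" "g \<in> carrier F" for f g k
    using inj[of "f \<ominus>\<^bsub>F\<^esub> g" k] mod_hom_adic_sub[OF N F I h, of "f \<ominus>\<^bsub>F\<^esub> g" k] that hd by auto
  have rcos: "(y \<in> ?S k +>\<^bsub>N\<^esub> x) \<longleftrightarrow> y \<ominus>\<^bsub>N\<^esub> x \<in> ?S k"
    if "x \<in> carrier N" "y \<in> carrier N" for x y k
    using S.a_rcos_module[OF that] by (simp add: N.M.minus_eq)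
  have rcosT: "(y \<in> ?T k +>\<^bsub>F\<^esub> x) \<longleftrightarrow> y \<ominus>\<^bsub>F\<^esub> x \<in> ?T k"
    if "x \<in> carrier F" "y \<in> carrier F" for x y k
    using T.a_rcos_module[OF that] by (simp add: F.M.minus_eq)
  have trans: "x \<ominus>\<^bsub>N\<^esub> z \<in> ?S k" if "x \<ominus>\<^bsub>N\<^esub> y \<in> ?S k" "y \<ominus>\<^bsub>N\<^esub> z \<in> ?S k"
    and "x \<in> carrier N" "y \<in> carrier N" "z \<in> carrier N" for x y z k
  proof -
    have "x \<ominus>\<^bsub>N\<^esub> z = (x \<ominus>\<^bsub>N\<^esub> y) \<oplus>\<^bsub>N\<^esub> (y \<ominus>\<^bsub>N\<^esub> z)"
      using that(3-5) by (simp add: N.M.minus_eq N.M.a_assoc N.M.r_neg2 N.M.r_neg1)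
    then show ?thesis using S.a_closed[OF that(1,2)] by simp
  qed
  have sym: "y \<ominus>\<^bsub>N\<^esub> x \<in> ?S k" if "x \<ominus>\<^bsub>N\<^esub> y \<in> ?S k" "x \<in> carrier N" "y \<in> carrier N" for x y k
  proof -
    have "y \<ominus>\<^bsub>N\<^esub> x = \<ominus>\<^bsub>N\<^esub> (x \<ominus>\<^bsub>N\<^esub> y)"
      using that(2,3) by (simp add: N.M.minus_eq N.M.minus_add N.M.a_comm)
    then show ?thesis using S.a_inv_closed[OF that(1)] by simp
  qed
  \<comment> \<open>\<open>H x k\<close> is the preimage under \<open>h\<close> of the coset of
    \<open>x\<close> modulo step \<open>k\<close>. \<open>dense\<close> makes it nonempty, and
    \<open>diff_in\<close> makes it a single coset in \<open>F\<close>.\<close>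
  define H where "H x k = {f \<in> carrier F. h f \<ominus>\<^bsub>N\<^esub> x \<in> ?S k}" for x k
  have H_coset: "H x k = ?T k +>\<^bsub>F\<^esub> f" if x: "x \<in> carrier N" and f: "f \<in> H x k" for x k f
  proof -
    have fc: "f \<in> carrier F" and fx: "h f \<ominus>\<^bsub>N\<^esub> x \<in> ?S k" using f by (auto simp: H_def)
    have "g \<in> H x k \<longleftrightarrow> g \<in> ?T k +>\<^bsub>F\<^esub> f" for g
    proof (cases "g \<in> carrier F")
      case True
      have "h g \<ominus>\<^bsub>N\<^esub> x \<in> ?S k \<longleftrightarrow> h g \<ominus>\<^bsub>N\<^esub> h f \<in> ?S k"
        using trans[of "h g" "h f" k x] trans[of "h g" x k "h f"] sym[OF fx] fx hc True fc x by blast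
      then show ?thesis using True fc by (simp add: rcosT diff_in H_def)
    next
      case False
      then show ?thesis using T.a_elemrcos_carrier[OF fc] by (auto simp: H_def)
    qed
    then show ?thesis by blast
  qed
  have H_ex: "\<exists>f. f \<in> H x k \<and> f \<in> carrier F" if "x \<in> carrier N" for x k
    using dense[OF that, of k] by (auto simp: H_def)
  let ?C = "adic_completion R I F"
  have HC: "H x \<in> carrier ?C" if x: "x \<in> carrier N" for x
  proof -
    have "H x i \<in> a_rcosets\<^bsub>F\<^esub> (?T i)" for i
      using H_ex[OF x, of i] H_coset[OF x] F.M.a_rcosetsI[OF T.a_subset] by metis
    moreover have "?T i <+>\<^bsub>F\<^esub> H x j = H x i" if ij: "i \<le> j" for i j
    proof -
      obtain f where f: "f \<in> H x j" "f \<in> carrier F" using H_ex[OF x] by blast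
      have f': "f \<in> H x i" using f(1) N.adic_sub_antimono[OF I ij] by (auto simp: H_def)
      show ?thesis
        unfolding H_coset[OF x f(1)] H_coset[OF x f']
        by (rule F.M.set_add_coset_absorb[OF T.additive_subgroup_axioms T.additive_subgroup_axioms
              F.adic_sub_antimono[OF I ij] f(2)])
    qed
    ultimately show ?thesis by (simp add: adic_completion_def quot_module_def)
  qed
  have H_hom: "H \<in> mod_hom R N ?C"
    unfolding mod_hom_def
  proof (intro CollectI conjI ballI)
    show "H \<in> carrier N \<rightarrow> carrier ?C" using HC by blast
  next
    fix x y assume x: "x \<in> carrier N" and y: "y \<in> carrier N"
    have "H (x \<oplus>\<^bsub>N\<^esub> y) k = H x k <+>\<^bsub>F\<^esub> H y k" for k
    proof -
      obtain f where f: "f \<in> H x k" "f \<in> carrier F" using H_ex[OF x] by blast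
      obtain g where g: "g \<in> H y k" "g \<in> carrier F" using H_ex[OF y] by blast
      have "h (f \<oplus>\<^bsub>F\<^esub> g) \<ominus>\<^bsub>N\<^esub> (x \<oplus>\<^bsub>N\<^esub> y) = (h f \<ominus>\<^bsub>N\<^esub> x) \<oplus>\<^bsub>N\<^esub> (h g \<ominus>\<^bsub>N\<^esub> y)"
        using f(2) g(2) x y hc by (simp add: ha N.M.minus_eq N.M.minus_add N.M.a_ac)
      then have "f \<oplus>\<^bsub>F\<^esub> g \<in> H (x \<oplus>\<^bsub>N\<^esub> y) k"
        using f g S.a_closed by (simp add: H_def)
      then show ?thesis
        using H_coset[OF x f(1)] H_coset[OF y g(1)] H_coset[of "x \<oplus>\<^bsub>N\<^esub> y"] x y
          T.a_rcos_sum[OF f(2) g(2)] by simp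
    qed
    then show "H (x \<oplus>\<^bsub>N\<^esub> y) = H x \<oplus>\<^bsub>?C\<^esub> H y"
      by (simp add: adic_completion_def quot_module_def fun_eq_iff)
  next
    fix r x assume r: "r \<in> carrier R" and x: "x \<in> carrier N"
    have "H (r \<odot>\<^bsub>N\<^esub> x) k = (\<Union>f\<in>H x k. ?T k +>\<^bsub>F\<^esub> (r \<odot>\<^bsub>F\<^esub> f))" for k
    proof -
      \<comment> \<open>Scalar multiplication of cosets is a union over representatives. All its
        members agree, and \<open>H_ex\<close> rules out the empty union.\<close>
      have *: "?T k +>\<^bsub>F\<^esub> (r \<odot>\<^bsub>F\<^esub> f) = H (r \<odot>\<^bsub>N\<^esub> x) k" if f: "f \<in> H x k" for f
      proof -
        have "h (r \<odot>\<^bsub>F\<^esub> f) \<ominus>\<^bsub>N\<^esub> (r \<odot>\<^bsub>N\<^esub> x) = r \<odot>\<^bsub>N\<^esub> (h f \<ominus>\<^bsub>N\<^esub> x)"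
          using f r x hc
          by (simp add: H_def hs N.M.minus_eq N.smult_r_distr N.smult_r_minus)
        then have "r \<odot>\<^bsub>F\<^esub> f \<in> H (r \<odot>\<^bsub>N\<^esub> x) k"
          using f r S.smult_closed by (simp add: H_def)
        then show ?thesis using H_coset[of "r \<odot>\<^bsub>N\<^esub> x"] r x by simp
      qed
      then show ?thesis using H_ex[OF x] by blast
    qed
    then show "H (r \<odot>\<^bsub>N\<^esub> x) = r \<odot>\<^bsub>?C\<^esub> H x"
      by (simp add: adic_completion_def quot_module_def fun_eq_iff)
  qed
  have bij: "bij_betw (\<lambda>x i. ?S i +>\<^bsub>N\<^esub> x) (carrier N) (carrier (adic_completion R I N))"
    using complete by (simp add: adically_complete_def mod_iso_def)
  \<comment> \<open>A common representative of \<open>H x k\<close> and \<open>H y k\<close> shows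
    that \<open>x\<close> and \<open>y\<close> agree modulo every step; the injective half of
    completeness then identifies them.\<close>
  have "inj_on H (carrier N)"
  proof (rule inj_onI)
    fix x y assume x: "x \<in> carrier N" and y: "y \<in> carrier N" and eq: "H x = H y"
    have "?S k +>\<^bsub>N\<^esub> x = ?S k +>\<^bsub>N\<^esub> y" for k
    proof -
      obtain f where f: "f \<in> H x k" "f \<in> carrier F" using H_ex[OF x] by blast
      then have "f \<in> H y k" using eq by simp
      then have "x \<ominus>\<^bsub>N\<^esub> y \<in> ?S k"
        using f x y hc sym trans[of x "h f" k y] by (simp add: H_def)
      then have "x \<in> ?S k +>\<^bsub>N\<^esub> y" using rcos x y by simp
      then show ?thesis
        using S.a_repr_independence'[of x k y] y by simp
    qed
    then show "x = y" using bij_betw_imp_inj_on[OF bij] x y by (simp add: inj_on_def)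
  qed
  moreover have "carrier ?C \<subseteq> H ` carrier N"
  proof
    fix Y assume Y: "Y \<in> carrier ?C"
    have "\<exists>f. f \<in> carrier F \<and> Y k = ?T k +>\<^bsub>F\<^esub> f" for k
    proof -
      have "Y k \<in> a_rcosets\<^bsub>F\<^esub> (?T k)"
        using Y by (simp add: adic_completion_def quot_module_def)
      then show ?thesis unfolding A_RCOSETS_def' by blast
    qed
    then obtain f where f: "\<And>k. f k \<in> carrier F" "\<And>k. Y k = ?T k +>\<^bsub>F\<^esub> f k" by metis
    have Yc: "?T i <+>\<^bsub>F\<^esub> Y j = Y i" if "i \<le> j" for i j
      using Y that by (simp add: adic_completion_def)
    have step: "h (f j) \<ominus>\<^bsub>N\<^esub> h (f i) \<in> ?S i" if ij: "i \<le> j" for i j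
    proof -
      have "f j \<in> Y j" using f T.a_rcos_self by simp
      moreover have "f j = \<zero>\<^bsub>F\<^esub> \<oplus>\<^bsub>F\<^esub> f j" using f by simp
      ultimately have "f j \<in> ?T i <+>\<^bsub>F\<^esub> Y j" using T.zero_closed unfolding set_add_def' by blast
      then have "f j \<in> ?T i +>\<^bsub>F\<^esub> f i" using Yc[OF ij] f by simp
      then show ?thesis using rcosT diff_in f by simp
    qed
    \<comment> \<open>The representatives \<open>f k\<close> need not converge in \<open>F\<close>.
      Their images form a compatible family in \<open>N\<close>, which the surjective half of
      completeness turns into one element \<open>x\<close>.\<close>
    let ?Z = "\<lambda>k. ?S k +>\<^bsub>N\<^esub> h (f k)"
    have "?S i <+>\<^bsub>N\<^esub> ?Z j = ?Z i" if ij: "i \<le> j" for i j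
    proof -
      have "?S i <+>\<^bsub>N\<^esub> ?Z j = ?S i +>\<^bsub>N\<^esub> h (f j)"
        by (rule N.M.set_add_coset_absorb[OF S.additive_subgroup_axioms S.additive_subgroup_axioms
              N.adic_sub_antimono[OF I ij] hc[OF f(1)]])
      also have "?S i +>\<^bsub>N\<^esub> h (f j) = ?S i +>\<^bsub>N\<^esub> h (f i)"
        using step[OF ij] rcos hc f by (intro S.a_repr_independence'[symmetric]) auto
      finally show ?thesis .
    qed
    moreover have "?Z i \<in> a_rcosets\<^bsub>N\<^esub> (?S i)" for i
      by (rule N.M.a_rcosetsI[OF S.a_subset hc[OF f(1)]])
    ultimately have "?Z \<in> carrier (adic_completion R I N)"
      by (simp add: adic_completion_def quot_module_def)
    then obtain x where x: "x \<in> carrier N" "?Z = (\<lambda>i. ?S i +>\<^bsub>N\<^esub> x)"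
      using bij by (metis (no_types, lifting) bij_betw_def imageE)
    have "Y k = H x k" for k
    proof -
      have "h (f k) \<in> ?S k +>\<^bsub>N\<^esub> x" using S.a_rcos_self[OF hc[OF f(1)]] x(2) by metis
      then have "f k \<in> H x k" using rcos x hc f by (simp add: H_def)
      then show ?thesis using H_coset x f by simp
    qed
    then show "Y \<in> H ` carrier N" using x(1) by blast
  qed
  ultimately have "H \<in> mod_iso R N ?C"
    using H_hom HC unfolding mod_iso_def bij_betw_def by blast
  then show ?thesis unfolding is_mod_iso_def by blast
qed


section \<open>Direct sums and linear combinations\<close>

context cring
begin

lemma direct_sum_module: "module R (direct_sum R J)"
proof (rule moduleI)
  show "abelian_group (direct_sum R J)"
  proof (rule abelian_groupI)
    fix f g assume "f \<in> carrier (direct_sum R J)" "g \<in> carrier (direct_sum R J)"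
    moreover have "{i. f i \<oplus> g i \<noteq> \<zero>} \<subseteq> {i. f i \<noteq> \<zero>} \<union> {i. g i \<noteq> \<zero>}" by auto
    ultimately show "f \<oplus>\<^bsub>direct_sum R J\<^esub> g \<in> carrier (direct_sum R J)"
      by (auto simp: direct_sum_def intro: finite_subset)
  next
    fix f assume f: "f \<in> carrier (direct_sum R J)"
    moreover have "{i. \<ominus> f i \<noteq> \<zero>} \<subseteq> {i. f i \<noteq> \<zero>}" by auto
    ultimately have "(\<lambda>i. \<ominus> f i) \<in> carrier (direct_sum R J)"
      by (auto simp: direct_sum_def intro: finite_subset)
    moreover have "(\<lambda>i. \<ominus> f i) \<oplus>\<^bsub>direct_sum R J\<^esub> f = \<zero>\<^bsub>direct_sum R J\<^esub>"
      using f by (auto simp: direct_sum_def l_neg)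
    ultimately show "\<exists>g\<in>carrier (direct_sum R J). g \<oplus>\<^bsub>direct_sum R J\<^esub> f = \<zero>\<^bsub>direct_sum R J\<^esub>"
      by blast
  qed (auto simp: direct_sum_def a_ac)
next
  fix a f assume a: "a \<in> carrier R" and f: "f \<in> carrier (direct_sum R J)"
  have "{i. a \<otimes> f i \<noteq> \<zero>} \<subseteq> {i. f i \<noteq> \<zero>}" using a by auto
  then show "a \<odot>\<^bsub>direct_sum R J\<^esub> f \<in> carrier (direct_sum R J)"
    using a f by (auto simp: direct_sum_def intro: finite_subset)
qed (auto simp: direct_sum_def l_distr r_distr m_assoc is_cring)

text \<open>Finite support makes \<open>f\<close> a finite sum of unit vectors multiplied by
  elements \<open>f j\<close> of \<open>I\<close>, and such multiples generate
  \<open>ideal_smult\<close>.\<close>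

lemma direct_sum_ideal_smultI:
  assumes I: "ideal I R" and f: "f \<in> carrier (direct_sum R J)" and fI: "\<And>j. f j \<in> I"
  shows "f \<in> ideal_smult (direct_sum R J) I"
proof -
  interpret F: module R "direct_sum R J" by (rule direct_sum_module)
  interpret S: submodule "ideal_smult (direct_sum R J) I" R "direct_sum R J"
    by (rule F.ideal_smult_submodule[OF I])
  have z: "(\<lambda>i. \<zero>) \<in> ideal_smult (direct_sum R J) I"
    using S.one_closed by (simp add: direct_sum_def)
  have "f \<in> ideal_smult (direct_sum R J) I"
    if "finite S" "{j. f j \<noteq> \<zero>} \<subseteq> S" "f \<in> carrier (direct_sum R J)" "\<And>j. f j \<in> I" for S f
    using that
  proof (induction S arbitrary: f rule: finite_induct)
    case empty
    then have "f = (\<lambda>i. \<zero>)" by auto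
    then show ?case using z by simp
  next
    case (insert s S)
    show ?case
    proof (cases "s \<in> J")
      case False
      then have "f s = \<zero>" using insert.prems(2) by (simp add: direct_sum_def)
      then show ?thesis using insert by blast
    next
      case True
      \<comment> \<open>\<open>?d\<close> is the unit vector at \<open>s\<close>, a member of the
        direct sum since \<open>s\<close> is in \<open>J\<close>; \<open>?g\<close> is
        \<open>f\<close> with the coordinate at \<open>s\<close> erased.\<close>
      let ?g = "f(s := \<zero>)" and ?d = "\<lambda>i. if i = s then \<one> else \<zero>"
      have fin: "finite {i. f i \<noteq> \<zero>}" and fc: "f i \<in> carrier R" for i
        using insert.prems(2) by (auto simp: direct_sum_def)
      have "{i. ?g i \<noteq> \<zero>} \<subseteq> {i. f i \<noteq> \<zero>}" by auto
      then have gc: "?g \<in> carrier (direct_sum R J)"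
        using insert.prems(2) by (auto simp: direct_sum_def intro: finite_subset)
      have dc: "?d \<in> carrier (direct_sum R J)"
        using True by (auto simp: direct_sum_def)
      have "?g \<in> ideal_smult (direct_sum R J) I"
        by (rule insert.IH[OF _ gc])
          (use insert.prems in \<open>auto simp: additive_subgroup.zero_closed[OF ideal.axioms(1)[OF I]]\<close>)
      moreover have "f s \<odot>\<^bsub>direct_sum R J\<^esub> ?d \<in> ideal_smult (direct_sum R J) I"
        by (rule F.ideal_smult_incl[OF insert.prems(3) dc])
      moreover have "f = ?g \<oplus>\<^bsub>direct_sum R J\<^esub> (f s \<odot>\<^bsub>direct_sum R J\<^esub> ?d)"
        using fc by (auto simp: direct_sum_def)
      ultimately show ?thesis using S.m_closed by (metis monoid.select_convs(1))
    qed
  qed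
  then show ?thesis using f fI by (auto simp: direct_sum_def)
qed

end

text \<open>The family \<open>v\<close> is kept separate from the indices, so that the same
  coefficients can be combined with the differentiated vectors \<open>d i (v j)\<close>.\<close>

definition lin_comb :: "('a, 'x) ring_scheme \<Rightarrow> ('a, 'm, 'y) module_scheme \<Rightarrow> ('i \<Rightarrow> 'm) \<Rightarrow> ('i \<Rightarrow> 'a) \<Rightarrow> 'm"
  where "lin_comb R M v f = (\<Oplus>\<^bsub>M\<^esub>j\<in>{j. f j \<noteq> \<zero>\<^bsub>R\<^esub>}. f j \<odot>\<^bsub>M\<^esub> v j)"

context module
begin

text \<open>Supports may shrink under addition, scaling and differentiation; this lets all sums
  concerned run over one common finite set.\<close>

lemma lin_comb_eq:
  assumes v: "v \<in> J \<rightarrow> carrier M" and f: "f \<in> carrier (direct_sum R J)"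
    and S: "finite S" "{j. f j \<noteq> \<zero>} \<subseteq> S" "S \<subseteq> J"
  shows "lin_comb R M v f = (\<Oplus>\<^bsub>M\<^esub>j\<in>S. f j \<odot>\<^bsub>M\<^esub> v j)"
  unfolding lin_comb_def
  by (rule M.add.finprod_mono_neutral_cong_left) (use assms in \<open>auto simp: direct_sum_def Pi_iff\<close>)

lemma lin_comb_hom:
  assumes v: "v \<in> J \<rightarrow> carrier M" shows "lin_comb R M v \<in> mod_hom R (direct_sum R J) M"
  unfolding mod_hom_def
proof (intro CollectI conjI ballI)
  show "lin_comb R M v \<in> carrier (direct_sum R J) \<rightarrow> carrier M"
    using v unfolding lin_comb_def by (auto simp: direct_sum_def Pi_iff intro!: M.finsum_closed)
next
  fix f g assume f: "f \<in> carrier (direct_sum R J)" and g: "g \<in> carrier (direct_sum R J)"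
  interpret F: module R "direct_sum R J" by (rule direct_sum_module)
  let ?S = "{j. f j \<noteq> \<zero>} \<union> {j. g j \<noteq> \<zero>}"
  have S: "finite ?S" "?S \<subseteq> J" using f g by (auto simp: direct_sum_def)
  have fg: "f \<oplus>\<^bsub>direct_sum R J\<^esub> g \<in> carrier (direct_sum R J)"
    "{j. (f \<oplus>\<^bsub>direct_sum R J\<^esub> g) j \<noteq> \<zero>} \<subseteq> ?S"
    using F.M.a_closed[OF f g] by (auto simp: direct_sum_def)
  have c: "f j \<in> carrier R" "g j \<in> carrier R" for j using f g by (auto simp: direct_sum_def)
  have vc: "v j \<in> carrier M" if "j \<in> ?S" for j using v S that by blast
  have "lin_comb R M v (f \<oplus>\<^bsub>direct_sum R J\<^esub> g) = (\<Oplus>\<^bsub>M\<^esub>j\<in>?S. (f j \<oplus> g j) \<odot>\<^bsub>M\<^esub> v j)"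
    using lin_comb_eq[OF v fg(1) S(1) fg(2) S(2)] by (simp add: direct_sum_def)
  also have "\<dots> = (\<Oplus>\<^bsub>M\<^esub>j\<in>?S. f j \<odot>\<^bsub>M\<^esub> v j \<oplus>\<^bsub>M\<^esub> g j \<odot>\<^bsub>M\<^esub> v j)"
    by (rule M.finsum_cong') (use c vc in \<open>auto simp: smult_l_distr\<close>)
  also have "\<dots> = (\<Oplus>\<^bsub>M\<^esub>j\<in>?S. f j \<odot>\<^bsub>M\<^esub> v j) \<oplus>\<^bsub>M\<^esub> (\<Oplus>\<^bsub>M\<^esub>j\<in>?S. g j \<odot>\<^bsub>M\<^esub> v j)"
    by (rule M.finsum_addf) (use c vc in auto)
  also have "\<dots> = lin_comb R M v f \<oplus>\<^bsub>M\<^esub> lin_comb R M v g"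
    using lin_comb_eq[OF v f S(1) _ S(2)] lin_comb_eq[OF v g S(1) _ S(2)] by auto
  finally show "lin_comb R M v (f \<oplus>\<^bsub>direct_sum R J\<^esub> g) = lin_comb R M v f \<oplus>\<^bsub>M\<^esub> lin_comb R M v g" .
next
  fix r f assume r: "r \<in> carrier R" and f: "f \<in> carrier (direct_sum R J)"
  interpret F: module R "direct_sum R J" by (rule direct_sum_module)
  let ?S = "{j. f j \<noteq> \<zero>}"
  have S: "finite ?S" "?S \<subseteq> J" using f by (auto simp: direct_sum_def)
  have c: "f j \<in> carrier R" for j using f by (auto simp: direct_sum_def)
  have vc: "v j \<in> carrier M" if "j \<in> ?S" for j using v S that by blast
  have rf: "r \<odot>\<^bsub>direct_sum R J\<^esub> f \<in> carrier (direct_sum R J)" by (rule F.smult_closed[OF r f])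
  have rS: "{j. (r \<odot>\<^bsub>direct_sum R J\<^esub> f) j \<noteq> \<zero>} \<subseteq> ?S"
    using r by (auto simp: direct_sum_def)
  have "lin_comb R M v (r \<odot>\<^bsub>direct_sum R J\<^esub> f) = (\<Oplus>\<^bsub>M\<^esub>j\<in>?S. (r \<otimes> f j) \<odot>\<^bsub>M\<^esub> v j)"
    using lin_comb_eq[OF v rf S(1) rS S(2)] by (simp add: direct_sum_def)
  also have "\<dots> = (\<Oplus>\<^bsub>M\<^esub>j\<in>?S. r \<odot>\<^bsub>M\<^esub> (f j \<odot>\<^bsub>M\<^esub> v j))"
    by (rule M.finsum_cong') (use r c vc in \<open>auto simp: smult_assoc1\<close>)
  also have "\<dots> = r \<odot>\<^bsub>M\<^esub> lin_comb R M v f"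
    unfolding lin_comb_def by (rule finsum_smult_ldistr[symmetric]) (use S r c vc in auto)
  finally show "lin_comb R M v (r \<odot>\<^bsub>direct_sum R J\<^esub> f) = r \<odot>\<^bsub>M\<^esub> lin_comb R M v f" .
qed

end


section \<open>Orders and derivatives of power series\<close>

text \<open>The k-th power of the variable ideal in terms of coefficients;
  \<open>var_ideal_pow\<close> proves the agreement.\<close>

definition ps_order_ge :: "('a, 'x) ring_scheme \<Rightarrow> nat \<Rightarrow> nat \<Rightarrow> (nat multiset \<Rightarrow> 'a) set"
  where "ps_order_ge A n k = {f \<in> carrier (power_series A n). \<forall>m. size m < k \<longrightarrow> f m = \<zero>\<^bsub>A\<^esub>}"

text \<open>The formal partial derivative: \<open>Suc (count m i)\<close> is the exponent of the
  variable \<open>i\<close> in \<open>add_mset i m\<close>. It is restricted to the carrier because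
  \<open>endo_ring\<close> consists of extensional functions. For \<open>i \<ge> n\<close> it is the
  zero operator.\<close>

definition ps_deriv ::
    "('a, 'x) ring_scheme \<Rightarrow> nat \<Rightarrow> nat \<Rightarrow> (nat multiset \<Rightarrow> 'a) \<Rightarrow> nat multiset \<Rightarrow> 'a"
  where "ps_deriv A n i = (\<lambda>f\<in>carrier (power_series A n).
    \<lambda>m. ([Suc (count m i)] \<cdot>\<^bsub>A\<^esub> \<one>\<^bsub>A\<^esub>) \<otimes>\<^bsub>A\<^esub> f (add_mset i m))"

context cring
begin

lemma ps_mult_coeff:
  "(f \<otimes>\<^bsub>power_series R n\<^esub> g) m = (\<Oplus>k\<in>{k. k \<subseteq># m}. f k \<otimes> g (m - k))"
  by (simp add: power_series_def)

lemma ps_add_coeff: "(f \<oplus>\<^bsub>power_series R n\<^esub> g) m = f m \<oplus> g m"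
  by (simp add: power_series_def)

lemma ps_smult_coeff: "(a \<odot>\<^bsub>power_series R n\<^esub> g) m = a \<otimes> g m"
  by (simp add: power_series_def)

lemma ps_zero_coeff: "\<zero>\<^bsub>power_series R n\<^esub> m = \<zero>"
  by (simp add: power_series_def)

lemma ps_coeff_outside:
  "f \<in> carrier (power_series R n) \<Longrightarrow> \<not> set_mset m \<subseteq> {..<n} \<Longrightarrow> f m = \<zero>"
  by (simp add: power_series_def)

lemma ps_minus_coeff:
  assumes f: "f \<in> carrier (power_series R n)"
  shows "(\<ominus>\<^bsub>power_series R n\<^esub> f) m = \<ominus> f m"
proof -
  interpret P: cring "power_series R n" by (rule power_series_cring)
  have "(\<lambda>m. \<ominus> f m) \<in> carrier (power_series R n)"
    "(\<lambda>m. \<ominus> f m) \<oplus>\<^bsub>power_series R n\<^esub> f = \<zero>\<^bsub>power_series R n\<^esub>"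
    using f by (auto simp: power_series_def l_neg)
  then show ?thesis using P.minus_equality f by metis
qed

lemma ps_const_coeff: "a \<in> carrier R \<Longrightarrow> ps_const R n a m = (if m = {#} then a else \<zero>)"
  by (simp add: ps_const_def power_series_def)

lemma ps_const_closed: "a \<in> carrier R \<Longrightarrow> ps_const R n a \<in> carrier (power_series R n)"
  by (auto simp: ps_const_coeff power_series_def)

lemma ps_mult_order_ge:
  assumes f: "f \<in> ps_order_ge R n k" and g: "g \<in> ps_order_ge R n l"
  shows "f \<otimes>\<^bsub>power_series R n\<^esub> g \<in> ps_order_ge R n (k + l)"
proof -
  have fc: "f \<in> carrier (power_series R n)" and gc: "g \<in> carrier (power_series R n)"
    using f g by (auto simp: ps_order_ge_def)
  have "(\<Oplus>j\<in>{j. j \<subseteq># m}. f j \<otimes> g (m - j)) = \<zero>" if m: "size m < k + l" for m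
  proof -
    have "f j \<otimes> g (m - j) = \<zero>" if "j \<subseteq># m" for j
    proof (cases "size j < k")
      case True
      then show ?thesis using f ps_coeff[OF gc] by (simp add: ps_order_ge_def)
    next
      case False
      then have "size (m - j) < l" using m that size_mset_mono[OF that] by (simp add: size_Diff_submset)
      then show ?thesis using g ps_coeff[OF fc] by (simp add: ps_order_ge_def)
    qed
    then have "(\<Oplus>j\<in>{j. j \<subseteq># m}. f j \<otimes> g (m - j)) = (\<Oplus>j\<in>{j. j \<subseteq># m}. \<zero>)"
      by (intro finsum_cong') auto
    then show ?thesis by simp
  qed
  then show ?thesis using ps_mult_closed[OF fc gc] by (simp add: ps_order_ge_def ps_mult_coeff)
qed

lemma ps_order_ge_0: "ps_order_ge R n 0 = carrier (power_series R n)"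
  by (auto simp: ps_order_ge_def)

lemma ps_order_ge_ideal: "ideal (ps_order_ge R n k) (power_series R n)"
proof -
  interpret P: cring "power_series R n" by (rule power_series_cring)
  show ?thesis
  proof (rule idealI[OF P.ring_axioms])
    show "subgroup (ps_order_ge R n k) (add_monoid (power_series R n))"
    proof (rule P.add.subgroupI)
      have "\<zero>\<^bsub>power_series R n\<^esub> \<in> ps_order_ge R n k"
        using P.zero_closed by (simp add: ps_order_ge_def ps_zero_coeff)
      then show "ps_order_ge R n k \<noteq> {}" by blast
    qed (auto simp: ps_order_ge_def ps_minus_coeff ps_add_coeff simp flip: a_inv_def)
  next
    fix f g assume f: "f \<in> ps_order_ge R n k" and g: "g \<in> carrier (power_series R n)"
    then show "g \<otimes>\<^bsub>power_series R n\<^esub> f \<in> ps_order_ge R n k"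
      "f \<otimes>\<^bsub>power_series R n\<^esub> g \<in> ps_order_ge R n k"
      using ps_mult_order_ge[of g n 0 f k] ps_mult_order_ge[of f n k g 0] by (simp_all add: ps_order_ge_0)
  qed
qed

lemma ps_var_order_ge: "i < n \<Longrightarrow> ps_var R i \<in> ps_order_ge R n 1"
  by (auto simp: ps_order_ge_def ps_var_def power_series_def)

lemma ps_var_closed: "i < n \<Longrightarrow> ps_var R i \<in> carrier (power_series R n)"
  using ps_var_order_ge[of i n] by (simp add: ps_order_ge_def)

lemma ps_mult_var_coeff:
  assumes f: "f \<in> carrier (power_series R n)" and i: "i < n"
  shows "(f \<otimes>\<^bsub>power_series R n\<^esub> ps_var R i) m = (if i \<in># m then f (m - {#i#}) else \<zero>)"
proof -
  note [simp] = ps_coeff[OF f]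
  have "(f \<otimes>\<^bsub>power_series R n\<^esub> ps_var R i) m = (ps_var R i \<otimes>\<^bsub>power_series R n\<^esub> f) m"
    using ps_mult_comm[OF f ps_var_closed[OF i]] by simp
  also have "\<dots> = (\<Oplus>k\<in>{k. k \<subseteq># m}. if {#i#} = k then f (m - k) else \<zero>)"
    unfolding ps_mult_coeff by (rule finsum_cong') (auto simp: ps_var_def)
  also have "\<dots> = (if i \<in># m then f (m - {#i#}) else \<zero>)"
  proof (cases "i \<in># m")
    case True
    then show ?thesis by (simp add: finsum_singleton finite_submultisets)
  next
    case False
    then have "(\<Oplus>k\<in>{k. k \<subseteq># m}. if {#i#} = k then f (m - k) else \<zero>) = (\<Oplus>k\<in>{k. k \<subseteq># m}. \<zero>)"
      by (intro finsum_cong') auto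
    then show ?thesis using False by simp
  qed
  finally show ?thesis .
qed

lemma var_ideal_ideal: "ideal (var_ideal R n) (power_series R n)"
proof -
  interpret P: cring "power_series R n" by (rule power_series_cring)
  show ?thesis unfolding var_ideal_def
    by (rule P.genideal_ideal) (use ps_var_closed in blast)
qed

lemma ps_var_in_var_ideal:
  assumes "i < n" shows "ps_var R i \<in> var_ideal R n"
proof -
  interpret P: cring "power_series R n" by (rule power_series_cring)
  have "ps_var R ` {..<n} \<subseteq> var_ideal R n" unfolding var_ideal_def
    by (rule P.genideal_self) (use ps_var_closed in blast)
  then show ?thesis using assms by blast
qed

lemma var_ideal_subset: "var_ideal R n \<subseteq> ps_order_ge R n 1"
proof -
  interpret P: cring "power_series R n" by (rule power_series_cring)
  show ?thesis unfolding var_ideal_def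
    by (rule P.genideal_minimal[OF ps_order_ge_ideal]) (use ps_var_order_ge in blast)
qed

text \<open>The finite number of variables enters here. A series may have infinitely many terms
  while \<open>ideal_prod\<close> admits finite sums only, but grouping the monomials by one
  variable dividing them leaves at most \<open>n\<close> products.\<close>

lemma ps_order_ge_Suc_subset:
  "ps_order_ge R n (Suc k) \<subseteq> ps_order_ge R n k \<cdot>\<^bsub>power_series R n\<^esub> var_ideal R n"
proof
  let ?Q = "ps_order_ge R n k \<cdot>\<^bsub>power_series R n\<^esub> var_ideal R n"
  interpret P: cring "power_series R n" by (rule power_series_cring)
  interpret Q: ideal ?Q "power_series R n"
    by (rule P.ideal_prod_is_ideal[OF ps_order_ge_ideal var_ideal_ideal])
  \<comment> \<open>A monomial is divided by its least variable.\<close>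
  have *: "f \<in> ?Q" if "j \<le> n" "f \<in> ps_order_ge R n (Suc k)" "\<And>m. f m \<noteq> \<zero> \<Longrightarrow> \<exists>i<j. i \<in># m" for f j
    using that
  proof (induction j arbitrary: f)
    case 0
    then have "f = \<zero>\<^bsub>power_series R n\<^esub>" by (auto simp: power_series_def)
    then show ?case by (simp add: Q.zero_closed)
  next
    case (Suc j)
    \<comment> \<open>\<open>g\<close> keeps the monomials that contain a variable below
      \<open>j\<close>. Every other monomial of \<open>f\<close> contains \<open>j\<close> itself,
      and \<open>h\<close> is the quotient of this remainder by that variable.\<close>
    define g where "g = (\<lambda>m. if \<exists>i<j. i \<in># m then f m else \<zero>)"
    define h where "h = (\<lambda>m. if \<exists>i<j. i \<in># m then \<zero> else f (add_mset j m))"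
    have fc: "f \<in> carrier (power_series R n)" and j: "j < n"
      using Suc.prems by (auto simp: ps_order_ge_def)
    have g: "g \<in> ps_order_ge R n (Suc k)" and h: "h \<in> ps_order_ge R n k"
      using Suc.prems(2) by (auto simp: g_def h_def ps_order_ge_def power_series_def)
    have "g \<in> ?Q" by (rule Suc.IH) (use Suc.prems(1) g in \<open>auto simp: g_def split: if_splits\<close>)
    moreover have "h \<otimes>\<^bsub>power_series R n\<^esub> ps_var R j \<in> ?Q"
      by (rule ideal_prod.prod[OF h ps_var_in_var_ideal[OF j]])
    moreover have "f = g \<oplus>\<^bsub>power_series R n\<^esub> (h \<otimes>\<^bsub>power_series R n\<^esub> ps_var R j)"
    proof
      fix m
      have hc: "h \<in> carrier (power_series R n)" using h by (simp add: ps_order_ge_def)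
      have "f m = g m \<oplus> (if j \<in># m then h (m - {#j#}) else \<zero>)"
      proof (cases "\<exists>i<j. i \<in># m")
        case True
        then obtain i where "i < j" "i \<in># m" by blast
        then have "i \<in># m - {#j#}" by (simp add: in_diff_count)
        then show ?thesis using True \<open>i < j\<close> ps_coeff[OF fc] by (auto simp: g_def h_def)
      next
        case no: False
        show ?thesis
        proof (cases "j \<in># m")
          case True
          then show ?thesis
            using no ps_coeff[OF fc] by (auto simp: g_def h_def dest: in_diffD)
        next
          case False
          then have "f m = \<zero>" using no Suc.prems(3)[of m] less_Suc_eq by metis
          then show ?thesis using no False by (simp add: g_def)
        qed
      qed
      then show "f m = (g \<oplus>\<^bsub>power_series R n\<^esub> (h \<otimes>\<^bsub>power_series R n\<^esub> ps_var R j)) m"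
        by (simp add: ps_add_coeff ps_mult_var_coeff[OF hc j])
    qed
    ultimately show ?case using Q.a_closed by metis
  qed
  fix f assume f: "f \<in> ps_order_ge R n (Suc k)"
  have "\<exists>i<n. i \<in># m" if "f m \<noteq> \<zero>" for m
  proof -
    have "set_mset m \<subseteq> {..<n}" "m \<noteq> {#}"
      using f that by (auto simp: ps_order_ge_def power_series_def)
    then show ?thesis by (metis lessThan_iff multiset_nonemptyE subsetD)
  qed
  then show "f \<in> ?Q" using *[OF order_refl f] by blast
qed

text \<open>Makes membership in a power of the ideal a condition on coefficients, to which
  derivatives can be applied.\<close>

lemma var_ideal_pow:
  "var_ideal R n [^]\<^bsub>ideals_set (power_series R n)\<^esub> k = ps_order_ge R n k"
proof (induction k)
  case 0
  then show ?case by (simp add: nat_pow_def ideals_set_def ps_order_ge_0)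
next
  case (Suc k)
  interpret S: ideal "ps_order_ge R n (Suc k)" "power_series R n" by (rule ps_order_ge_ideal)
  have "f \<in> ps_order_ge R n (Suc k)"
    if "f \<in> ps_order_ge R n k \<cdot>\<^bsub>power_series R n\<^esub> var_ideal R n" for f
    using that
  proof (induction rule: ideal_prod.induct)
    case (prod f g)
    then show ?case using ps_mult_order_ge[of f n k g 1] var_ideal_subset by auto
  qed simp
  then have "ps_order_ge R n k \<cdot>\<^bsub>power_series R n\<^esub> var_ideal R n = ps_order_ge R n (Suc k)"
    using ps_order_ge_Suc_subset by blast
  then show ?case using Suc.IH by (simp add: nat_pow_def ideals_set_def)
qed

lemma var_ideal_eq: "var_ideal R n = ps_order_ge R n 1"
proof -
  interpret P: cring "power_series R n" by (rule power_series_cring)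
  have "ps_order_ge R n 1 \<subseteq> var_ideal R n"
    using ps_order_ge_Suc_subset[of n 0] P.ideal_prod_inter[OF ps_order_ge_ideal var_ideal_ideal]
    by auto
  then show ?thesis using var_ideal_subset by blast
qed

section \<open>Partial derivatives of power series\<close>

lemma ps_deriv_coeff:
  "f \<in> carrier (power_series R n) \<Longrightarrow>
    ps_deriv R n i f m = ([Suc (count m i)] \<cdot> \<one>) \<otimes> f (add_mset i m)"
  by (simp add: ps_deriv_def)

lemma ps_deriv_closed:
  assumes "f \<in> carrier (power_series R n)" shows "ps_deriv R n i f \<in> carrier (power_series R n)"
  using assms by (auto simp: ps_deriv_def power_series_def)

lemma ps_deriv_order_ge:
  "f \<in> ps_order_ge R n (Suc k) \<Longrightarrow> ps_deriv R n i f \<in> ps_order_ge R n k"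
  using ps_deriv_closed[of f n i] by (auto simp: ps_order_ge_def ps_deriv_coeff)

text \<open>The exponent of a variable is additive over a factorisation of a monomial. This splits
  the integer factor of each term of the convolution in two, one part for each summand of the
  rule.\<close>

lemma ps_deriv_mult:
  assumes f: "f \<in> carrier (power_series R n)" and g: "g \<in> carrier (power_series R n)"
  shows "ps_deriv R n i (f \<otimes>\<^bsub>power_series R n\<^esub> g) =
    (ps_deriv R n i f \<otimes>\<^bsub>power_series R n\<^esub> g) \<oplus>\<^bsub>power_series R n\<^esub>
    (f \<otimes>\<^bsub>power_series R n\<^esub> ps_deriv R n i g)"
proof
  fix m
  note c [simp] = ps_coeff[OF f] ps_coeff[OF g]
  let ?M = "add_mset i m" and ?N = "\<lambda>c::nat. [c] \<cdot> \<one>"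
  have split: "?N (count ?M i) \<otimes> (f k \<otimes> g (?M - k)) =
      ?N (count k i) \<otimes> (f k \<otimes> g (?M - k)) \<oplus> ?N (count (?M - k) i) \<otimes> (f k \<otimes> g (?M - k))"
    if k: "k \<subseteq># ?M" for k
  proof -
    have "count ?M i = count k i + count (?M - k) i"
      using mset_subset_eq_count[OF k, of i] by (simp del: count_add_mset)
    then have "?N (count ?M i) = ?N (count k i) \<oplus> ?N (count (?M - k) i)"
      by (simp only: add.nat_pow_mult[OF one_closed])
    then show ?thesis by (simp add: l_distr del: count_add_mset count_diff)
  qed
  have "ps_deriv R n i (f \<otimes>\<^bsub>power_series R n\<^esub> g) m =
      ?N (count ?M i) \<otimes> (\<Oplus>k\<in>{k. k \<subseteq># ?M}. f k \<otimes> g (?M - k))"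
    by (simp add: ps_deriv_coeff[OF ps_mult_closed[OF f g]] ps_mult_coeff)
  also have "\<dots> = (\<Oplus>k\<in>{k. k \<subseteq># ?M}. ?N (count ?M i) \<otimes> (f k \<otimes> g (?M - k)))"
    by (rule finsum_rdistr) (auto simp: finite_submultisets)
  also have "\<dots> = (\<Oplus>k\<in>{k. k \<subseteq># ?M}. ?N (count k i) \<otimes> (f k \<otimes> g (?M - k)) \<oplus>
      ?N (count (?M - k) i) \<otimes> (f k \<otimes> g (?M - k)))"
    by (rule finsum_cong') (use split in auto)
  also have "\<dots> = (\<Oplus>k\<in>{k. k \<subseteq># ?M}. ?N (count k i) \<otimes> (f k \<otimes> g (?M - k))) \<oplus>
      (\<Oplus>k\<in>{k. k \<subseteq># ?M}. ?N (count (?M - k) i) \<otimes> (f k \<otimes> g (?M - k)))"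
    by (rule finsum_addf) auto
  \<comment> \<open>Divisors without the variable \<open>i\<close> carry the integer factor 0; the
    others are \<open>add_mset i k\<close> with \<open>k\<close> a divisor of
    \<open>m\<close>.\<close>
  also have "(\<Oplus>k\<in>{k. k \<subseteq># ?M}. ?N (count k i) \<otimes> (f k \<otimes> g (?M - k))) =
      (\<Oplus>k\<in>add_mset i ` {k. k \<subseteq># m}. ?N (count k i) \<otimes> (f k \<otimes> g (?M - k)))"
  proof (rule add.finprod_mono_neutral_cong_right)
    show "?N (count k i) \<otimes> (f k \<otimes> g (?M - k)) = \<zero>"
      if k: "k \<in> {k. k \<subseteq># ?M} - add_mset i ` {k. k \<subseteq># m}" for k
    proof -
      have "i \<notin># k"
      proof
        assume "i \<in># k"
        then obtain k' where "k = add_mset i k'" by (metis multi_member_split)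
        then show False using k by auto
      qed
      then show ?thesis by (simp add: not_in_iff)
    qed
  qed (auto simp: finite_submultisets)
  also have "\<dots> = (\<Oplus>k\<in>{k. k \<subseteq># m}. ?N (Suc (count k i)) \<otimes> (f (add_mset i k) \<otimes> g (m - k)))"
    by (subst finsum_reindex) (auto simp: inj_on_def)
  also have "\<dots> = (ps_deriv R n i f \<otimes>\<^bsub>power_series R n\<^esub> g) m"
    unfolding ps_mult_coeff by (rule finsum_cong') (use f in \<open>auto simp: ps_deriv_coeff m_assoc\<close>)
  \<comment> \<open>A divisor of \<open>?M\<close> that does not divide \<open>m\<close> uses up
    every factor \<open>i\<close>, so its integer factor is 0.\<close>
  also have "(\<Oplus>k\<in>{k. k \<subseteq># ?M}. ?N (count (?M - k) i) \<otimes> (f k \<otimes> g (?M - k))) =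
      (\<Oplus>k\<in>{k. k \<subseteq># m}. ?N (count (?M - k) i) \<otimes> (f k \<otimes> g (?M - k)))"
  proof (rule add.finprod_mono_neutral_cong_right)
    show "?N (count (?M - k) i) \<otimes> (f k \<otimes> g (?M - k)) = \<zero>"
      if k: "k \<in> {k. k \<subseteq># ?M} - {k. k \<subseteq># m}" for k
    proof -
      have "count (?M - k) i = 0"
      proof (rule ccontr)
        assume "count (?M - k) i \<noteq> 0"
        then have "i \<in># ?M - k" by (simp add: not_in_iff del: count_diff)
        then obtain l where l: "?M - k = add_mset i l" by (metis multi_member_split)
        have "?M = k + (?M - k)" using k by simp
        then have "m = k + l" using l by simp
        then show False using k by simp
      qed
      then show ?thesis by (simp del: count_diff)
    qed
  qed (auto simp: finite_submultisets intro: subset_mset.order_trans)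
  also have "\<dots> = (f \<otimes>\<^bsub>power_series R n\<^esub> ps_deriv R n i g) m"
    unfolding ps_mult_coeff
  proof (rule finsum_cong')
    fix k assume "k \<in> {k. k \<subseteq># m}"
    then have "?M - k = add_mset i (m - k)"
      by (metis add_mset_add_single mem_Collect_eq subset_mset.add_diff_assoc2)
    then show "?N (count (?M - k) i) \<otimes> (f k \<otimes> g (?M - k)) = f k \<otimes> ps_deriv R n i g (m - k)"
      using g by (simp add: ps_deriv_coeff m_lcomm del: count_diff)
  qed (use g in \<open>auto simp: ps_deriv_coeff\<close>)
  finally show "ps_deriv R n i (f \<otimes>\<^bsub>power_series R n\<^esub> g) m =
      ((ps_deriv R n i f \<otimes>\<^bsub>power_series R n\<^esub> g) \<oplus>\<^bsub>power_series R n\<^esub>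
      (f \<otimes>\<^bsub>power_series R n\<^esub> ps_deriv R n i g)) m"
    by (simp add: ps_add_coeff)
qed

lemma ps_deriv_endo: "ps_deriv R n i \<in> carrier (endo_ring R (power_series R n))"
proof -
  interpret B: algebra R "power_series R n" by (rule power_series_algebra)
  have "ps_deriv R n i (f \<oplus>\<^bsub>power_series R n\<^esub> g) =
      ps_deriv R n i f \<oplus>\<^bsub>power_series R n\<^esub> ps_deriv R n i g"
    if "f \<in> carrier (power_series R n)" "g \<in> carrier (power_series R n)" for f g
    using that ps_coeff[OF that(1)] ps_coeff[OF that(2)]
    by (simp add: fun_eq_iff ps_deriv_coeff ps_add_coeff r_distr)
  moreover have "ps_deriv R n i (a \<odot>\<^bsub>power_series R n\<^esub> f) =
      a \<odot>\<^bsub>power_series R n\<^esub> ps_deriv R n i f"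
    if "a \<in> carrier R" "f \<in> carrier (power_series R n)" for a f
    using that ps_coeff[OF that(2)] by (simp add: fun_eq_iff ps_deriv_coeff ps_smult_coeff m_lcomm)
  ultimately show ?thesis
    using ps_deriv_closed by (auto simp: endo_ring_def mod_hom_def ps_deriv_def)
qed

lemma ps_deriv_Leibniz:
  assumes b: "b \<in> carrier (power_series R n)"
  shows "ps_deriv R n i \<otimes>\<^bsub>endo_ring R (power_series R n)\<^esub> mult_op (power_series R n) b =
    mult_op (power_series R n) (ps_deriv R n i b) \<oplus>\<^bsub>endo_ring R (power_series R n)\<^esub>
    mult_op (power_series R n) b \<otimes>\<^bsub>endo_ring R (power_series R n)\<^esub> ps_deriv R n i"
  using ps_deriv_mult[OF b] ps_mult_closed[OF b] ps_deriv_closed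
  by (auto simp: endo_ring_def mult_op_def compose_def intro!: restrict_ext)

text \<open>By the Leibniz rule the commutator with multiplication by \<open>b\<close> is
  multiplication by minus the derivative of \<open>b\<close>, which has order 0; so the derivative
  has order at most one.\<close>

lemma ps_deriv_diff_op: "ps_deriv R n i \<in> carrier (diff_ops R (power_series R n))"
proof -
  interpret B: algebra R "power_series R n" by (rule power_series_algebra)
  let ?E = "endo_ring R (power_series R n)"
  interpret E: ring ?E by (rule B.endo_ring_ring)
  have "ps_deriv R n i \<in> diff_ops_le R (power_series R n) (Suc 0)"
  proof (rule B.diff_ops_le_SucI[OF ps_deriv_endo])
    fix b assume b: "b \<in> carrier (power_series R n)"
    let ?b = "mult_op (power_series R n) b" and ?d = "mult_op (power_series R n) (ps_deriv R n i b)"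
    have e: "?b \<in> carrier ?E" "?d \<in> carrier ?E"
      by (rule B.mult_op_endo[OF b], rule B.mult_op_endo[OF ps_deriv_closed[OF b]])
    have "x \<ominus>\<^bsub>?E\<^esub> (d \<oplus>\<^bsub>?E\<^esub> x) = \<ominus>\<^bsub>?E\<^esub> d" if "x \<in> carrier ?E" "d \<in> carrier ?E" for x d
      using that E.a_lcomm[of x "\<ominus>\<^bsub>?E\<^esub> d" "\<ominus>\<^bsub>?E\<^esub> x"] by (simp add: E.minus_eq E.minus_add E.r_neg)
    then have "?b \<otimes>\<^bsub>?E\<^esub> ps_deriv R n i \<ominus>\<^bsub>?E\<^esub> ps_deriv R n i \<otimes>\<^bsub>?E\<^esub> ?b = \<ominus>\<^bsub>?E\<^esub> ?d"
      unfolding ps_deriv_Leibniz[OF b] using e E.m_closed[OF e(1) ps_deriv_endo] by blast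
    moreover have "\<ominus>\<^bsub>?E\<^esub> ?d \<in> diff_ops_le R (power_series R n) 0"
      by (intro B.diff_ops_le_closed(3) B.diff_ops_le_closed(1) ps_deriv_closed b)
    ultimately show "?b \<otimes>\<^bsub>?E\<^esub> ps_deriv R n i \<ominus>\<^bsub>?E\<^esub> ps_deriv R n i \<otimes>\<^bsub>?E\<^esub> ?b
        \<in> diff_ops_le R (power_series R n) 0" by simp
  qed
  then show ?thesis by (auto simp: diff_ops_def)
qed

end

section \<open>Consequences of containing the rationals\<close>

text \<open>The image of \<open>1 / (k + 1)\<close> inverts the integer factor.\<close>

lemma contains_rat_nat_cancel:
  assumes A: "cring A" and Q: "contains_rat A" and a: "a \<in> carrier A"
    and eq: "([Suc k] \<cdot>\<^bsub>A\<^esub> \<one>\<^bsub>A\<^esub>) \<otimes>\<^bsub>A\<^esub> a = \<zero>\<^bsub>A\<^esub>"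
  shows "a = \<zero>\<^bsub>A\<^esub>"
proof -
  interpret A: cring A by fact
  obtain h where h: "h \<in> ring_hom rat_ring A" using Q by (auto simp: contains_rat_def)
  have hc: "h q \<in> carrier A" and ha: "h (p + q) = h p \<oplus>\<^bsub>A\<^esub> h q"
    and hm: "h (p * q) = h p \<otimes>\<^bsub>A\<^esub> h q" and h1: "h 1 = \<one>\<^bsub>A\<^esub>" for p q
    using h by (auto simp: ring_hom_def rat_ring_def)
  have "h (of_nat j) = [j] \<cdot>\<^bsub>A\<^esub> \<one>\<^bsub>A\<^esub>" for j
  proof (induction j)
    case 0
    \<comment> \<open>A \<open>ring_hom\<close> preserves zero because \<open>h 0\<close> is
      idempotent under addition.\<close>
    have "h 0 \<oplus>\<^bsub>A\<^esub> h 0 = h 0" using ha[of 0 0] by simp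
    then show ?case using hc[of 0] by simp
  next
    case (Suc j)
    then show ?case using ha[of "of_nat j" 1] h1 by (simp add: add.commute)
  qed
  then have "h (1 / of_nat (Suc k)) \<otimes>\<^bsub>A\<^esub> ([Suc k] \<cdot>\<^bsub>A\<^esub> \<one>\<^bsub>A\<^esub>) = h (1 / of_nat (Suc k) * of_nat (Suc k))"
    by (simp only: hm)
  also have "\<dots> = \<one>\<^bsub>A\<^esub>" using h1 by (simp del: of_nat_Suc)
  finally have "h (1 / of_nat (Suc k)) \<otimes>\<^bsub>A\<^esub> (([Suc k] \<cdot>\<^bsub>A\<^esub> \<one>\<^bsub>A\<^esub>) \<otimes>\<^bsub>A\<^esub> a) = a"
    using a hc by (metis A.add.nat_pow_closed A.l_one A.m_assoc A.one_closed)
  then show ?thesis using eq hc by simp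
qed

text \<open>Nontriviality of \<open>A\<close> will keep the lifts of different basis vectors
  distinct. It comes from the injectivity in \<open>contains_rat\<close>, as the zero ring would
  identify the images of 0 and 1.\<close>

lemma contains_rat_one_not_zero:
  assumes A: "cring A" and Q: "contains_rat A" shows "\<one>\<^bsub>A\<^esub> \<noteq> \<zero>\<^bsub>A\<^esub>"
proof
  interpret A: cring A by fact
  assume "\<one>\<^bsub>A\<^esub> = \<zero>\<^bsub>A\<^esub>"
  then have "x = \<zero>\<^bsub>A\<^esub>" if "x \<in> carrier A" for x
    using that A.one_zeroD by blast
  moreover obtain h where "h \<in> ring_hom rat_ring A" "inj_on h (carrier rat_ring)"
    using Q by (auto simp: contains_rat_def)
  then have "h 0 \<in> carrier A" "h 1 \<in> carrier A" "h 0 \<noteq> h 1"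
    using inj_onD[of h UNIV 0 1] by (auto simp: ring_hom_def rat_ring_def)
  ultimately show False by metis
qed

text \<open>A nonempty monomial is \<open>add_mset i m'\<close> for some variable, and its
  coefficient, times a positive integer, is a coefficient of the i-th derivative one degree lower.
  Derivatives do not see the constant term, which the assumption on \<open>f\<close> covers.\<close>

lemma ps_order_ge_SucI:
  assumes A: "cring A" and Q: "contains_rat A" and f: "f \<in> ps_order_ge A n 1"
    and d: "\<And>i. i < n \<Longrightarrow> ps_deriv A n i f \<in> ps_order_ge A n k"
  shows "f \<in> ps_order_ge A n (Suc k)"
proof -
  interpret A: cring A by fact
  have fc: "f \<in> carrier (power_series A n)" using f by (simp add: ps_order_ge_def)
  have "f m = \<zero>\<^bsub>A\<^esub>" if m: "size m < Suc k" for m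
  proof (cases "set_mset m \<subseteq> {..<n} \<and> m \<noteq> {#}")
    case False
    then show ?thesis using f A.ps_coeff_outside[OF fc] by (auto simp: ps_order_ge_def)
  next
    case True
    then obtain i m' where m': "m = add_mset i m'" by (metis multiset_cases)
    then have "i < n" "size m' < k" using True m by auto
    then have "ps_deriv A n i f m' = \<zero>\<^bsub>A\<^esub>" using d by (auto simp: ps_order_ge_def)
    then show ?thesis
      using contains_rat_nat_cancel[OF A Q A.ps_coeff[OF fc]] m' by (simp add: A.ps_deriv_coeff[OF fc])
  qed
  then show ?thesis using fc by (simp add: ps_order_ge_def)
qed


section \<open>Modules over the ring of differential operators\<close>

text \<open>\<open>mult_op B\<close> is a ring homomorphism from \<open>B\<close> to the
  differential operators, by \<open>add\<close>, \<open>mult\<close> and \<open>one\<close>; scalars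
  are restricted along it.\<close>

lemma diff_module_restrict_scalars:
  assumes A: "algebra A B" and M: "left_module (diff_ops A B) M"
  shows "module B (restrict_scalars (mult_op B) M)"
proof -
  interpret B: algebra A B by fact
  interpret M: left_module "diff_ops A B" M by fact
  have c: "mult_op B b \<in> carrier (diff_ops A B)" if "b \<in> carrier B" for b
    using B.diff_ops_le_closed(1)[OF that, of 0] by (auto simp: diff_ops_def)
  have add: "mult_op B (a \<oplus>\<^bsub>B\<^esub> b) = mult_op B a \<oplus>\<^bsub>diff_ops A B\<^esub> mult_op B b"
    if "a \<in> carrier B" "b \<in> carrier B" for a b
    using that by (auto simp: diff_ops_def endo_ring_def mult_op_def B.l_distr intro!: restrict_ext)
  have mult: "mult_op B (a \<otimes>\<^bsub>B\<^esub> b) = mult_op B a \<otimes>\<^bsub>diff_ops A B\<^esub> mult_op B b"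
    if "a \<in> carrier B" "b \<in> carrier B" for a b
    using that by (auto simp: diff_ops_def endo_ring_def mult_op_def compose_def B.m_assoc intro!: restrict_ext)
  have one: "mult_op B \<one>\<^bsub>B\<^esub> = \<one>\<^bsub>diff_ops A B\<^esub>"
    by (auto simp: diff_ops_def endo_ring_def mult_op_def)
  show ?thesis
  proof (rule moduleI)
    show "abelian_group (restrict_scalars (mult_op B) M)"
    proof (rule abelian_groupI)
      fix x assume "x \<in> carrier (restrict_scalars (mult_op B) M)"
      then show "\<exists>y\<in>carrier (restrict_scalars (mult_op B) M).
          y \<oplus>\<^bsub>restrict_scalars (mult_op B) M\<^esub> x = \<zero>\<^bsub>restrict_scalars (mult_op B) M\<^esub>"
        by (auto simp: restrict_scalars_def M.M.l_neg intro!: bexI[of _ "\<ominus>\<^bsub>M\<^esub> x"])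
    qed (auto simp: restrict_scalars_def M.M.a_ac)
  qed (use c in \<open>auto simp: restrict_scalars_def add mult one B.M_cring
      M.smult_l_distr M.smult_r_distr M.smult_assoc1\<close>)
qed

text \<open>The operator identity \<open>ps_deriv_Leibniz\<close>, carried over to the module by
  associativity and distributivity of the action.\<close>

lemma ps_deriv_smult:
  assumes A: "cring A" and M: "left_module (diff_ops A (power_series A n)) M"
    and b: "b \<in> carrier (power_series A n)" and x: "x \<in> carrier M"
  shows "ps_deriv A n i \<odot>\<^bsub>M\<^esub> (mult_op (power_series A n) b \<odot>\<^bsub>M\<^esub> x) =
    mult_op (power_series A n) (ps_deriv A n i b) \<odot>\<^bsub>M\<^esub> x \<oplus>\<^bsub>M\<^esub>
    mult_op (power_series A n) b \<odot>\<^bsub>M\<^esub> (ps_deriv A n i \<odot>\<^bsub>M\<^esub> x)"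
proof -
  interpret A: cring A by fact
  interpret B: algebra A "power_series A n" by (rule A.power_series_algebra)
  interpret M: left_module "diff_ops A (power_series A n)" M by fact
  let ?D = "diff_ops A (power_series A n)" and ?m = "mult_op (power_series A n)"
  have c: "?m b \<in> carrier ?D" if "b \<in> carrier (power_series A n)" for b
    using B.diff_ops_le_closed(1)[OF that, of 0] by (auto simp: diff_ops_def)
  note d = A.ps_deriv_diff_op[of n i] and b' = A.ps_deriv_closed[OF b, of i]
  have "ps_deriv A n i \<otimes>\<^bsub>?D\<^esub> ?m b = ?m (ps_deriv A n i b) \<oplus>\<^bsub>?D\<^esub> ?m b \<otimes>\<^bsub>?D\<^esub> ps_deriv A n i"
    using A.ps_deriv_Leibniz[OF b, of i] by (simp add: diff_ops_def)
  then show ?thesis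
    using M.smult_assoc1[OF d c[OF b] x] M.smult_assoc1[OF c[OF b] d x] d c[OF b] c[OF b'] x
    by (simp add: M.smult_l_distr)
qed

context module
begin

lemma lin_comb_in_subgroup:
  assumes S: "additive_subgroup S M" and f: "\<And>j. f j \<noteq> \<zero> \<Longrightarrow> f j \<odot>\<^bsub>M\<^esub> v j \<in> S"
  shows "lin_comb R M v f \<in> S"
proof -
  interpret S: additive_subgroup S M by fact
  have *: "(\<Oplus>\<^bsub>M\<^esub>j\<in>T. f j \<odot>\<^bsub>M\<^esub> v j) \<in> S" if "\<And>j. j \<in> T \<Longrightarrow> f j \<odot>\<^bsub>M\<^esub> v j \<in> S" for T
    using that
  proof (induction T rule: infinite_finite_induct)
    case (insert t T)
    then have "(\<lambda>j. f j \<odot>\<^bsub>M\<^esub> v j) \<in> insert t T \<rightarrow> carrier M" using S.a_subset by blast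
    then show ?case using insert S.a_closed by (simp add: Pi_iff)
  qed auto
  show ?thesis unfolding lin_comb_def by (rule *) (use f in auto)
qed

end

text \<open>If \<open>\<Sum> f\<^sub>j v\<^sub>j\<close> lies in the \<open>(k + 1)\<close>-st step, then \<open>f\<close> has order at least \<open>k\<close> by induction, so
  applying a derivation \<open>\<partial>\<close> gives \<open>\<Sum> (\<partial> f\<^sub>j) v\<^sub>j\<close> in the \<open>k\<close>-th step up to \<open>\<Sum> f\<^sub>j (\<partial> v\<^sub>j)\<close>, which also
  lies there. Hence all \<open>\<partial> f\<^sub>j\<close> have order at least \<open>k\<close>.\<close>

lemma lin_comb_order_ge:
  fixes d :: "nat \<Rightarrow> 'm \<Rightarrow> 'm" and N :: "(nat multiset \<Rightarrow> 'a, 'm, 'y) module_scheme"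
  assumes A: "cring A" and Q: "contains_rat A" and N: "module (power_series A n) N"
    and dhom: "\<And>i. abelian_group_hom N N (d i)"
    and Leibniz: "\<And>i b x. b \<in> carrier (power_series A n) \<Longrightarrow> x \<in> carrier N \<Longrightarrow>
      d i (b \<odot>\<^bsub>N\<^esub> x) = (ps_deriv A n i b \<odot>\<^bsub>N\<^esub> x) \<oplus>\<^bsub>N\<^esub> (b \<odot>\<^bsub>N\<^esub> d i x)"
    and v: "v \<in> J \<rightarrow> carrier N"
    and free: "\<And>f j. f \<in> carrier (direct_sum (power_series A n) J) \<Longrightarrow>
      lin_comb (power_series A n) N v f \<in> ideal_smult N (var_ideal A n) \<Longrightarrow> f j \<in> ps_order_ge A n 1"
    and f: "f \<in> carrier (direct_sum (power_series A n) J)"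
    and fk: "lin_comb (power_series A n) N v f \<in> adic_sub (power_series A n) (var_ideal A n) N k"
  shows "f j \<in> ps_order_ge A n k"
proof -
  interpret A: cring A by fact
  let ?P = "power_series A n"
  let ?S = "adic_sub ?P (var_ideal A n) N"
  interpret N: module ?P N by fact
  show ?thesis
    using f fk
  \<comment> \<open>\<open>f\<close> is generalised because the hypothesis is used twice: for
    \<open>f\<close> itself, to control the undifferentiated coefficients, and for the family
    \<open>g\<close> of derivatives.\<close>
  proof (induction k arbitrary: f j)
    case 0
    then show ?case by (simp add: A.ps_order_ge_0 direct_sum_def)
  next
    case (Suc k)
    interpret S: abelian_subgroup "?S k" N
      by (rule N.submodule_abelian_subgroup[OF N.adic_sub_submodule[OF A.var_ideal_ideal]])
    have S_eq: "?S l = ideal_smult N (ps_order_ge A n l)" for l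
      by (simp add: adic_sub_def A.var_ideal_pow)
    have "?S (Suc k) \<subseteq> ?S k" "?S (Suc k) \<subseteq> ?S 1"
      by (rule N.adic_sub_antimono[OF A.var_ideal_ideal], simp)+
    \<comment> \<open>\<open>fk\<close> feeds the induction hypothesis; \<open>f1\<close> yields
      vanishing constant terms through \<open>free\<close>, which is how independence modulo the
      ideal enters.\<close>
    then have fk: "lin_comb ?P N v f \<in> ?S k" and f1: "lin_comb ?P N v f \<in> ideal_smult N (var_ideal A n)"
      using Suc.prems(2) S_eq[of 1] by (auto simp: A.var_ideal_eq)
    show ?case
    proof (rule ps_order_ge_SucI[OF A Q])
      show "f j \<in> ps_order_ge A n 1" by (rule free[OF Suc.prems(1) f1])
    next
      fix i
      interpret d: abelian_group_hom N N "d i" by (rule dhom)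
      \<comment> \<open>On a generator \<open>b x\<close> the Leibniz rule gives two terms, one with
        a coefficient of order at least \<open>k\<close>, the other with the coefficient
        \<open>b\<close> of order at least \<open>k + 1\<close>. Both lie in step
        \<open>k\<close>.\<close>
      have dS: "d i x \<in> ?S k" if "x \<in> ?S (Suc k)" for x
      proof -
        have "?S (Suc k) \<subseteq> {x \<in> carrier N. d i x \<in> ?S k}"
          unfolding S_eq[of "Suc k"]
        proof (rule N.ideal_smult_least[OF d.vimage_additive_subgroup[OF S.additive_subgroup_axioms]])
          fix b x assume b: "b \<in> ps_order_ge A n (Suc k)" and x: "x \<in> carrier N"
          then have bc: "b \<in> carrier ?P" and bk: "b \<in> ps_order_ge A n k" by (auto simp: ps_order_ge_def)
          have "ps_deriv A n i b \<odot>\<^bsub>N\<^esub> x \<in> ?S k" "b \<odot>\<^bsub>N\<^esub> d i x \<in> ?S k"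
            unfolding S_eq by (intro N.ideal_smult_incl A.ps_deriv_order_ge b x bk d.hom_closed)+
          then show "b \<odot>\<^bsub>N\<^esub> x \<in> {x \<in> carrier N. d i x \<in> ?S k}"
            using bc x Leibniz by simp
        qed
        then show ?thesis using that by blast
      qed
      define g where "g = (\<lambda>j. ps_deriv A n i (f j))"
      have fc: "f j \<in> carrier ?P" for j using Suc.prems(1) by (simp add: direct_sum_def)
      have "ps_deriv A n i \<zero>\<^bsub>?P\<^esub> = \<zero>\<^bsub>?P\<^esub>"
        by (simp add: fun_eq_iff A.ps_deriv_coeff A.ps_zero_coeff)
      then have sub: "{j. g j \<noteq> \<zero>\<^bsub>?P\<^esub>} \<subseteq> {j. f j \<noteq> \<zero>\<^bsub>?P\<^esub>}" and gJ: "\<And>j. j \<notin> J \<Longrightarrow> g j = \<zero>\<^bsub>?P\<^esub>"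
        using Suc.prems(1) by (auto simp: g_def direct_sum_def)
      have fin: "finite {j. f j \<noteq> \<zero>\<^bsub>?P\<^esub>}" "{j. f j \<noteq> \<zero>\<^bsub>?P\<^esub>} \<subseteq> J"
        using Suc.prems(1) by (auto simp: direct_sum_def)
      have g: "g \<in> carrier (direct_sum ?P J)"
        using gJ A.ps_deriv_closed fc finite_subset[OF sub fin(1)] by (simp add: direct_sum_def g_def)
      have vc: "v j \<in> carrier N" if "f j \<noteq> \<zero>\<^bsub>?P\<^esub>" for j using v fin that by blast
      have gc: "g j \<in> carrier ?P" for j using A.ps_deriv_closed[OF fc] by (simp add: g_def)
      \<comment> \<open>The sums run over the support of \<open>f\<close>, since derivatives of
        nonzero coefficients may vanish.\<close>
      let ?T = "{j. f j \<noteq> \<zero>\<^bsub>?P\<^esub>}"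
      have "d i (lin_comb ?P N v f) = (\<Oplus>\<^bsub>N\<^esub>j\<in>?T. d i (f j \<odot>\<^bsub>N\<^esub> v j))"
        unfolding lin_comb_def by (rule d.hom_finsum) (use fc vc in auto)
      also have "\<dots> = (\<Oplus>\<^bsub>N\<^esub>j\<in>?T. g j \<odot>\<^bsub>N\<^esub> v j \<oplus>\<^bsub>N\<^esub> f j \<odot>\<^bsub>N\<^esub> d i (v j))"
        by (rule N.M.finsum_cong') (use fc vc gc Leibniz in \<open>auto simp: g_def\<close>)
      also have "\<dots> = (\<Oplus>\<^bsub>N\<^esub>j\<in>?T. g j \<odot>\<^bsub>N\<^esub> v j) \<oplus>\<^bsub>N\<^esub> (\<Oplus>\<^bsub>N\<^esub>j\<in>?T. f j \<odot>\<^bsub>N\<^esub> d i (v j))"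
        by (rule N.M.finsum_addf) (use fc vc gc in auto)
      also have "(\<Oplus>\<^bsub>N\<^esub>j\<in>?T. g j \<odot>\<^bsub>N\<^esub> v j) = lin_comb ?P N v g"
        by (rule N.lin_comb_eq[OF v g fin(1) sub fin(2), symmetric])
      also have "(\<Oplus>\<^bsub>N\<^esub>j\<in>?T. f j \<odot>\<^bsub>N\<^esub> d i (v j)) = lin_comb ?P N (\<lambda>j. d i (v j)) f"
        by (simp add: lin_comb_def)
      finally have eq: "d i (lin_comb ?P N v f) = lin_comb ?P N v g \<oplus>\<^bsub>N\<^esub> lin_comb ?P N (\<lambda>j. d i (v j)) f" .
      have rest: "lin_comb ?P N (\<lambda>j. d i (v j)) f \<in> ?S k"
      proof (rule N.lin_comb_in_subgroup[OF S.additive_subgroup_axioms])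
        fix j assume "f j \<noteq> \<zero>\<^bsub>?P\<^esub>"
        then show "f j \<odot>\<^bsub>N\<^esub> d i (v j) \<in> ?S k"
          unfolding S_eq by (intro N.ideal_smult_incl Suc.IH[OF Suc.prems(1) fk] d.hom_closed vc)
      qed
      have gN: "lin_comb ?P N v g \<in> carrier N"
        using N.lin_comb_hom[OF v] g by (auto simp: mod_hom_def)
      have "lin_comb ?P N v g = d i (lin_comb ?P N v f) \<ominus>\<^bsub>N\<^esub> lin_comb ?P N (\<lambda>j. d i (v j)) f"
        unfolding eq using gN rest S.a_subset by (auto simp: N.M.minus_eq N.M.a_assoc N.M.r_neg)
      then have "lin_comb ?P N v g \<in> ?S k"
        using dS[OF Suc.prems(2)] rest S.a_closed S.a_inv_closed by (simp add: N.M.minus_eq)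
      from Suc.IH[OF g this] show "ps_deriv A n i (f j) \<in> ps_order_ge A n k" by (simp add: g_def)
    qed
  qed
qed

section \<open>Lifting a basis of the quotient\<close>

text \<open>Trades cosets for a map on \<open>N\<close> itself. Series act through their constant
  terms because \<open>b\<close> and the constant series of \<open>b {#}\<close> differ by an
  element of the variable ideal.\<close>

lemma free_module_quotient_map:
  fixes N :: "(nat multiset \<Rightarrow> 'a, 'm, 'y) module_scheme"
  assumes A: "cring A" and N: "module (power_series A n) N"
    and free: "free_module A (restrict_scalars (ps_const A n)
      (quot_module N (ideal_smult N (var_ideal A n))))"
  obtains I :: "'m set set" and p where "abelian_group_hom N (direct_sum A I) p"
    and "p ` carrier N = carrier (direct_sum A I)"
    and "\<And>x. x \<in> carrier N \<Longrightarrow> p x = \<zero>\<^bsub>direct_sum A I\<^esub> \<longleftrightarrow> x \<in> ideal_smult N (var_ideal A n)"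
    and "\<And>b x. b \<in> carrier (power_series A n) \<Longrightarrow> x \<in> carrier N \<Longrightarrow>
      p (b \<odot>\<^bsub>N\<^esub> x) = b {#} \<odot>\<^bsub>direct_sum A I\<^esub> p x"
proof -
  interpret A: cring A by fact
  let ?P = "power_series A n"
  interpret P: algebra A ?P by (rule A.power_series_algebra)
  interpret N: module ?P N by fact
  let ?T = "ideal_smult N (var_ideal A n)"
  let ?Q = "restrict_scalars (ps_const A n) (quot_module N ?T)"
  interpret T: submodule ?T ?P N by (rule N.ideal_smult_submodule[OF A.var_ideal_ideal])
  interpret T: abelian_subgroup ?T N by (rule N.submodule_abelian_subgroup[OF T.submodule_axioms])
  obtain I :: "'m set set" and h where h: "h \<in> mod_iso A ?Q (direct_sum A I)"
    using free by (auto simp: free_module_def is_mod_iso_def)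
  interpret F: module A "direct_sum A I" by (rule A.direct_sum_module)
  have Qc: "carrier ?Q = a_rcosets\<^bsub>N\<^esub> ?T" by (simp add: restrict_scalars_def quot_module_def)
  have bij: "bij_betw h (a_rcosets\<^bsub>N\<^esub> ?T) (carrier (direct_sum A I))"
    using h by (simp add: mod_iso_def Qc)
  have hadd: "h (X <+>\<^bsub>N\<^esub> Y) = h X \<oplus>\<^bsub>direct_sum A I\<^esub> h Y"
    if "X \<in> a_rcosets\<^bsub>N\<^esub> ?T" "Y \<in> a_rcosets\<^bsub>N\<^esub> ?T" for X Y
    using h that by (simp add: mod_iso_def mod_hom_def restrict_scalars_def quot_module_def)
  have hsmult: "h (\<Union>x\<in>X. ?T +>\<^bsub>N\<^esub> (ps_const A n a \<odot>\<^bsub>N\<^esub> x)) = a \<odot>\<^bsub>direct_sum A I\<^esub> h X"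
    if "X \<in> a_rcosets\<^bsub>N\<^esub> ?T" "a \<in> carrier A" for X a
    using h that by (simp add: mod_iso_def mod_hom_def restrict_scalars_def quot_module_def)
  define p where "p x = h (?T +>\<^bsub>N\<^esub> x)" for x
  have cos: "?T +>\<^bsub>N\<^esub> x \<in> a_rcosets\<^bsub>N\<^esub> ?T" if "x \<in> carrier N" for x
    using that by (rule N.M.a_rcosetsI[OF T.a_subset])
  have coseq: "?T +>\<^bsub>N\<^esub> x = ?T +>\<^bsub>N\<^esub> y \<longleftrightarrow> x \<ominus>\<^bsub>N\<^esub> y \<in> ?T"
    if "x \<in> carrier N" "y \<in> carrier N" for x y
    using T.a_rcos_module[OF that(2,1)] T.a_repr_independence'[of x y] T.a_rcos_self[OF that(1)] that
    by (auto simp: N.M.minus_eq)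
  show ?thesis
  proof (rule that)
    show hom: "abelian_group_hom N (direct_sum A I) p"
    proof (rule abelian_group_homI')
      show "p \<in> carrier N \<rightarrow> carrier (direct_sum A I)"
        using cos bij_betwE[OF bij] by (simp add: p_def)
      fix x y assume x: "x \<in> carrier N" and y: "y \<in> carrier N"
      show "p (x \<oplus>\<^bsub>N\<^esub> y) = p x \<oplus>\<^bsub>direct_sum A I\<^esub> p y"
        unfolding p_def T.a_rcos_sum[OF x y, symmetric] by (rule hadd[OF cos[OF x] cos[OF y]])
    qed (rule N.M.abelian_group_axioms F.M.abelian_group_axioms)+
    interpret p: abelian_group_hom N "direct_sum A I" p by (rule hom)
    have "a_rcosets\<^bsub>N\<^esub> ?T = (\<lambda>x. ?T +>\<^bsub>N\<^esub> x) ` carrier N" by (auto simp: A_RCOSETS_def')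
    then show "p ` carrier N = carrier (direct_sum A I)"
      using bij_betw_imp_surj_on[OF bij] by (simp add: p_def image_image)
    show ker: "p x = \<zero>\<^bsub>direct_sum A I\<^esub> \<longleftrightarrow> x \<in> ?T" if x: "x \<in> carrier N" for x
    proof -
      have "p x = \<zero>\<^bsub>direct_sum A I\<^esub> \<longleftrightarrow> p x = p \<zero>\<^bsub>N\<^esub>" by simp
      also have "\<dots> \<longleftrightarrow> ?T +>\<^bsub>N\<^esub> x = ?T +>\<^bsub>N\<^esub> \<zero>\<^bsub>N\<^esub>"
        unfolding p_def using inj_on_eq_iff[OF bij_betw_imp_inj_on[OF bij] cos cos] x by simp
      also have "\<dots> \<longleftrightarrow> x \<in> ?T" using coseq[OF x N.M.zero_closed] x N.M.minus_equality[of "\<zero>\<^bsub>N\<^esub>" "\<zero>\<^bsub>N\<^esub>"]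
        by (simp add: N.M.minus_eq)
      finally show ?thesis .
    qed
    fix b x assume b: "b \<in> carrier ?P" and x: "x \<in> carrier N"
    let ?c = "ps_const A n (b {#})"
    have b0: "b {#} \<in> carrier A" by (rule A.ps_coeff[OF b])
    have cc: "?c \<in> carrier ?P" by (rule A.ps_const_closed[OF b0])
    have "b \<ominus>\<^bsub>?P\<^esub> ?c \<in> carrier ?P" using b cc by simp
    then have "b \<ominus>\<^bsub>?P\<^esub> ?c \<in> var_ideal A n"
      using b0 by (simp add: A.var_ideal_eq ps_order_ge_def P.M.minus_eq A.ps_add_coeff
          A.ps_minus_coeff[OF cc] A.ps_const_coeff A.r_neg)
    then have "(b \<ominus>\<^bsub>?P\<^esub> ?c) \<odot>\<^bsub>N\<^esub> x \<in> ?T" using x by (rule N.ideal_smult_incl)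
    moreover have "b \<odot>\<^bsub>N\<^esub> x = (b \<ominus>\<^bsub>?P\<^esub> ?c) \<odot>\<^bsub>N\<^esub> x \<oplus>\<^bsub>N\<^esub> ?c \<odot>\<^bsub>N\<^esub> x"
    proof -
      have "b = (b \<ominus>\<^bsub>?P\<^esub> ?c) \<oplus>\<^bsub>?P\<^esub> ?c"
        using b cc by (simp add: P.M.minus_eq P.M.a_assoc P.M.l_neg)
      then show ?thesis using N.smult_l_distr[of "b \<ominus>\<^bsub>?P\<^esub> ?c" ?c x] b cc x by simp
    qed
    moreover have "(\<Union>y\<in>?T +>\<^bsub>N\<^esub> x. ?T +>\<^bsub>N\<^esub> (?c \<odot>\<^bsub>N\<^esub> y)) = ?T +>\<^bsub>N\<^esub> (?c \<odot>\<^bsub>N\<^esub> x)"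
    proof -
      have "?T +>\<^bsub>N\<^esub> (?c \<odot>\<^bsub>N\<^esub> y) = ?T +>\<^bsub>N\<^esub> (?c \<odot>\<^bsub>N\<^esub> x)" if y: "y \<in> ?T +>\<^bsub>N\<^esub> x" for y
      proof -
        have yc: "y \<in> carrier N" using T.a_elemrcos_carrier[OF x y] .
        have "?c \<odot>\<^bsub>N\<^esub> (y \<oplus>\<^bsub>N\<^esub> \<ominus>\<^bsub>N\<^esub> x) \<in> ?T"
          using T.a_rcos_module_imp[OF x y] cc by simp
        then show ?thesis
          using coseq[of "?c \<odot>\<^bsub>N\<^esub> y" "?c \<odot>\<^bsub>N\<^esub> x"] cc x yc
          by (simp add: N.M.minus_eq N.smult_r_distr N.smult_r_minus)
      qed
      then show ?thesis using T.a_rcos_self[OF x] by blast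
    qed
    then have "p (?c \<odot>\<^bsub>N\<^esub> x) = b {#} \<odot>\<^bsub>direct_sum A I\<^esub> p x"
      using hsmult[OF cos[OF x] b0] by (simp add: p_def)
    ultimately show "p (b \<odot>\<^bsub>N\<^esub> x) = b {#} \<odot>\<^bsub>direct_sum A I\<^esub> p x"
      using ker[of "(b \<ominus>\<^bsub>?P\<^esub> ?c) \<odot>\<^bsub>N\<^esub> x"] b cc x F.smult_closed[OF b0 p.hom_closed[OF x]]
      by simp
  qed
qed

text \<open>The basis of the quotient is indexed inside the type of cosets, whereas
  \<open>adically_free\<close> asks for indices in the type of elements of \<open>N\<close>. Since
  the lift \<open>e\<close> is injective, the lifted vectors can serve as their own indices, with
  the identity as family.\<close>

lemma quotient_basis_lift:
  fixes N :: "(nat multiset \<Rightarrow> 'a, 'm, 'y) module_scheme"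
  assumes A: "cring A" and A0: "\<one>\<^bsub>A\<^esub> \<noteq> \<zero>\<^bsub>A\<^esub>" and N: "module (power_series A n) N"
    and free: "free_module A (restrict_scalars (ps_const A n)
      (quot_module N (ideal_smult N (var_ideal A n))))"
  obtains J where "J \<subseteq> carrier N"
    and "\<And>f j. f \<in> carrier (direct_sum (power_series A n) J) \<Longrightarrow>
      lin_comb (power_series A n) N (\<lambda>x. x) f \<in> ideal_smult N (var_ideal A n) \<Longrightarrow>
      f j \<in> ps_order_ge A n 1"
    and "\<And>x. x \<in> carrier N \<Longrightarrow> \<exists>f\<in>carrier (direct_sum (power_series A n) J).
      lin_comb (power_series A n) N (\<lambda>x. x) f \<ominus>\<^bsub>N\<^esub> x \<in> ideal_smult N (var_ideal A n)"
proof -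
  interpret A: cring A by fact
  let ?P = "power_series A n"
  interpret P: algebra A ?P by (rule A.power_series_algebra)
  interpret N: module ?P N by fact
  let ?T = "ideal_smult N (var_ideal A n)"
  obtain I :: "'m set set" and p where p: "abelian_group_hom N (direct_sum A I) p"
    and surj: "p ` carrier N = carrier (direct_sum A I)"
    and ker: "\<And>x. x \<in> carrier N \<Longrightarrow> p x = \<zero>\<^bsub>direct_sum A I\<^esub> \<longleftrightarrow> x \<in> ?T"
    and smult: "\<And>b x. b \<in> carrier ?P \<Longrightarrow> x \<in> carrier N \<Longrightarrow>
      p (b \<odot>\<^bsub>N\<^esub> x) = b {#} \<odot>\<^bsub>direct_sum A I\<^esub> p x"
    using free_module_quotient_map[OF A N free] by blast
  interpret p: abelian_group_hom N "direct_sum A I" p by fact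
  have pc: "p x i \<in> carrier A" "i \<notin> I \<Longrightarrow> p x i = \<zero>\<^bsub>A\<^esub>" if "x \<in> carrier N" for x i
    using p.hom_closed[OF that] by (auto simp: direct_sum_def)
  have pi: "abelian_group_hom N A (\<lambda>x. p x i)" for i
    by (rule abelian_group_homI')
      (use pc p.hom_add N.M.abelian_group_axioms A.abelian_group_axioms in \<open>auto simp: direct_sum_def\<close>)
  have "(\<lambda>j. if j = i then \<one>\<^bsub>A\<^esub> else \<zero>\<^bsub>A\<^esub>) \<in> carrier (direct_sum A I)" if "i \<in> I" for i
    using that by (simp add: direct_sum_def)
  then have "\<exists>x. x \<in> carrier N \<and> p x = (\<lambda>j. if j = i then \<one>\<^bsub>A\<^esub> else \<zero>\<^bsub>A\<^esub>)" if "i \<in> I" for i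
    using that surj by (metis (no_types, lifting) imageE)
  then obtain e where e: "\<And>i. i \<in> I \<Longrightarrow> e i \<in> carrier N"
    and pe: "\<And>i j. i \<in> I \<Longrightarrow> p (e i) j = (if j = i then \<one>\<^bsub>A\<^esub> else \<zero>\<^bsub>A\<^esub>)" by metis
  have einj: "inj_on e I"
    by (rule inj_onI) (use pe A0 in metis)
  let ?J = "e ` I" and ?L = "lin_comb ?P N (\<lambda>x. x)"
  have J: "(\<lambda>x. x) \<in> ?J \<rightarrow> carrier N" using e by auto
  have Lc: "?L f \<in> carrier N" if "f \<in> carrier (direct_sum ?P ?J)" for f
    using N.lin_comb_hom[OF J] that by (auto simp: mod_hom_def)
  \<comment> \<open>Both conclusions rest on this: the image of a combination is given by its
    constant coefficients. A zero image forces them to vanish, and prescribing them reaches every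
    image.\<close>
  have pL: "p (?L f) i = f (e i) {#}" if f: "f \<in> carrier (direct_sum ?P ?J)" and i: "i \<in> I" for f i
  proof -
    interpret pi: abelian_group_hom N A "\<lambda>x. p x i" by (rule pi)
    have fc: "f j \<in> carrier ?P" for j using f by (simp add: direct_sum_def)
    \<comment> \<open>\<open>e i\<close> is inserted so that the single surviving term is indexed
      even if \<open>f (e i)\<close> is zero.\<close>
    let ?S = "insert (e i) {j. f j \<noteq> \<zero>\<^bsub>?P\<^esub>}"
    have S: "finite ?S" "?S \<subseteq> ?J" using f i by (auto simp: direct_sum_def)
    have Sc: "j \<in> carrier N" if "j \<in> ?S" for j using S(2) that e by auto
    have "?L f = (\<Oplus>\<^bsub>N\<^esub>j\<in>?S. f j \<odot>\<^bsub>N\<^esub> j)"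
      by (rule N.lin_comb_eq[OF J f S(1) _ S(2)]) auto
    then have "p (?L f) i = p (\<Oplus>\<^bsub>N\<^esub>j\<in>?S. f j \<odot>\<^bsub>N\<^esub> j) i" by simp
    also have "\<dots> = (\<Oplus>\<^bsub>A\<^esub>j\<in>?S. p (f j \<odot>\<^bsub>N\<^esub> j) i)"
      by (rule pi.hom_finsum) (use fc Sc in auto)
    also have "\<dots> = (\<Oplus>\<^bsub>A\<^esub>j\<in>?S. if e i = j then f j {#} else \<zero>\<^bsub>A\<^esub>)"
    proof (rule A.finsum_cong')
      fix j assume j: "j \<in> ?S"
      then obtain l where l: "l \<in> I" "j = e l" using S(2) by blast
      have "p (f j \<odot>\<^bsub>N\<^esub> j) i = f j {#} \<otimes>\<^bsub>A\<^esub> p j i"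
        using smult[OF fc Sc[OF j]] by (simp add: direct_sum_def)
      also have "\<dots> = (if e i = j then f j {#} else \<zero>\<^bsub>A\<^esub>)"
        using pe[OF l(1)] l i A.ps_coeff[OF fc] inj_on_eq_iff[OF einj i l(1)] by auto
      finally show "p (f j \<odot>\<^bsub>N\<^esub> j) i = (if e i = j then f j {#} else \<zero>\<^bsub>A\<^esub>)" .
    qed (use A.ps_coeff[OF fc] in auto)
    also have "\<dots> = f (e i) {#}"
      by (rule A.finsum_singleton) (use S A.ps_coeff[OF fc] in auto)
    finally show ?thesis .
  qed
  show ?thesis
  proof (rule that)
    show "?J \<subseteq> carrier N" using e by auto
  next
    fix f j assume f: "f \<in> carrier (direct_sum ?P ?J)" and fT: "?L f \<in> ?T"
    have "f j {#} = \<zero>\<^bsub>A\<^esub>"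
    proof (cases "j \<in> ?J")
      case True
      then obtain i where i: "i \<in> I" "j = e i" by blast
      have "p (?L f) = \<zero>\<^bsub>direct_sum A I\<^esub>" using ker[OF Lc[OF f]] fT by simp
      then show ?thesis using pL[OF f i(1)] i by (simp add: direct_sum_def)
    next
      case False
      then show ?thesis using f by (simp add: direct_sum_def A.ps_zero_coeff)
    qed
    then show "f j \<in> ps_order_ge A n 1" using f by (simp add: ps_order_ge_def direct_sum_def)
  next
    fix x assume x: "x \<in> carrier N"
    define f where "f = (\<lambda>j. if j \<in> ?J then ps_const A n (p x (the_inv_into I e j)) else \<zero>\<^bsub>?P\<^esub>)"
    have fe: "f (e i) = ps_const A n (p x i)" if "i \<in> I" for i
      using that by (simp add: f_def the_inv_into_f_f[OF einj])
    have const0: "ps_const A n \<zero>\<^bsub>A\<^esub> = \<zero>\<^bsub>?P\<^esub>"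
      by (simp add: fun_eq_iff A.ps_zero_coeff A.ps_const_coeff)
    have "{j. f j \<noteq> \<zero>\<^bsub>?P\<^esub>} \<subseteq> e ` {i. p x i \<noteq> \<zero>\<^bsub>A\<^esub>}"
    proof
      fix j assume j: "j \<in> {j. f j \<noteq> \<zero>\<^bsub>?P\<^esub>}"
      then obtain i where i: "i \<in> I" "j = e i" by (auto simp: f_def split: if_splits)
      then show "j \<in> e ` {i. p x i \<noteq> \<zero>\<^bsub>A\<^esub>}" using j fe const0 by auto
    qed
    moreover have "finite {i. p x i \<noteq> \<zero>\<^bsub>A\<^esub>}"
      using p.hom_closed[OF x] by (simp add: direct_sum_def)
    ultimately have "finite {j. f j \<noteq> \<zero>\<^bsub>?P\<^esub>}" by (meson finite_imageI finite_subset)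
    then have f: "f \<in> carrier (direct_sum ?P ?J)"
      using A.ps_const_closed pc[OF x] by (auto simp: direct_sum_def f_def)
    have "p (?L f) i = p x i" for i
      using pL[OF f, of i] fe[of i] A.ps_const_coeff pc[OF x, of i] pc(2)[OF Lc[OF f], of i] by (cases "i \<in> I") auto
    then have "p (?L f) = p x" by blast
    then have "p (?L f \<ominus>\<^bsub>N\<^esub> x) = \<zero>\<^bsub>direct_sum A I\<^esub>"
      using p.hom_minus[OF Lc[OF f] x] p.hom_closed[OF x] by (simp add: p.H.minus_eq p.H.r_neg)
    then have "?L f \<ominus>\<^bsub>N\<^esub> x \<in> ?T" using ker Lc[OF f] x by simp
    then show "\<exists>f\<in>carrier (direct_sum ?P ?J). ?L f \<ominus>\<^bsub>N\<^esub> x \<in> ?T" using f by blast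
  qed
qed

theorem corollary0p8:
  fixes A :: "('a, 'x) ring_scheme"
    and n :: nat
    and M :: "((nat multiset \<Rightarrow> 'a) \<Rightarrow> (nat multiset \<Rightarrow> 'a), 'm, 'y) module_scheme"
  assumes "cring A"
    and "contains_rat A"
    and "left_module (diff_ops A (power_series A n)) M"
    and "adically_complete (power_series A n) (var_ideal A n)
           (restrict_scalars (mult_op (power_series A n)) M)"
    and "free_module A
           (restrict_scalars (ps_const A n)
             (quot_module (restrict_scalars (mult_op (power_series A n)) M)
               (ideal_smult (restrict_scalars (mult_op (power_series A n)) M) (var_ideal A n))))"
  shows "adically_free (power_series A n) (var_ideal A n)
           (restrict_scalars (mult_op (power_series A n)) M)"
proof -
  interpret A: cring A by fact
  let ?P = "power_series A n"
  interpret P: algebra A ?P by (rule A.power_series_algebra)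
  interpret M: left_module "diff_ops A ?P" M by fact
  let ?N = "restrict_scalars (mult_op ?P) M"
  have N: "module ?P ?N"
    by (rule diff_module_restrict_scalars[OF A.power_series_algebra assms(3)])
  interpret N: module ?P ?N by (rule N)
  obtain J where J: "J \<subseteq> carrier ?N"
    and free: "\<And>f j. f \<in> carrier (direct_sum ?P J) \<Longrightarrow>
      lin_comb ?P ?N (\<lambda>x. x) f \<in> ideal_smult ?N (var_ideal A n) \<Longrightarrow> f j \<in> ps_order_ge A n 1"
    and dense: "\<And>x. x \<in> carrier ?N \<Longrightarrow> \<exists>f\<in>carrier (direct_sum ?P J).
      lin_comb ?P ?N (\<lambda>x. x) f \<ominus>\<^bsub>?N\<^esub> x \<in> ideal_smult ?N (var_ideal A n)"
    using quotient_basis_lift[OF assms(1) contains_rat_one_not_zero[OF assms(1,2)] N assms(5)] by blast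
  have v: "(\<lambda>x. x) \<in> J \<rightarrow> carrier ?N" using J by blast
  \<comment> \<open>Derivatives are scalars of \<open>M\<close> but not of \<open>?N\<close>, which
    retains the action of the power series only; they survive there as additive maps.\<close>
  define d where "d i x = ps_deriv A n i \<odot>\<^bsub>M\<^esub> x" for i x
  have dhom: "abelian_group_hom ?N ?N (d i)" for i
    by (rule abelian_group_homI') (use A.ps_deriv_diff_op N.M.abelian_group_axioms in
      \<open>auto simp: d_def restrict_scalars_def M.smult_r_distr\<close>)
  have Leibniz: "d i (b \<odot>\<^bsub>?N\<^esub> x) = (ps_deriv A n i b \<odot>\<^bsub>?N\<^esub> x) \<oplus>\<^bsub>?N\<^esub> (b \<odot>\<^bsub>?N\<^esub> d i x)"
    if "b \<in> carrier ?P" "x \<in> carrier ?N" for i b x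
    using ps_deriv_smult[OF assms(1,3), of b x i] that by (simp add: d_def restrict_scalars_def)
  have F: "module ?P (direct_sum ?P J)" by (rule P.direct_sum_module)
  note hom = N.lin_comb_hom[OF v]
  have "is_mod_iso ?P ?N (adic_completion ?P (var_ideal A n) (direct_sum ?P J))"
  proof (rule adic_completion_iso[OF N F A.var_ideal_ideal hom _ _ assms(4)])
    fix k f assume f: "f \<in> carrier (direct_sum ?P J)"
      and fk: "lin_comb ?P ?N (\<lambda>x. x) f \<in> adic_sub ?P (var_ideal A n) ?N k"
    have "f j \<in> ps_order_ge A n k" for j
      by (rule lin_comb_order_ge[where d = d and v = "\<lambda>x. x", OF assms(1,2) N])
        (fact dhom Leibniz v f fk | erule (1) free)+
    then show "f \<in> adic_sub ?P (var_ideal A n) (direct_sum ?P J) k"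
      unfolding adic_sub_def A.var_ideal_pow
      by (rule P.direct_sum_ideal_smultI[OF A.ps_order_ge_ideal f])
  next
    fix k x assume x: "x \<in> carrier ?N"
    show "\<exists>f\<in>carrier (direct_sum ?P J).
        lin_comb ?P ?N (\<lambda>x. x) f \<ominus>\<^bsub>?N\<^esub> x \<in> adic_sub ?P (var_ideal A n) ?N k"
      by (rule mod_hom_adic_dense[OF N F A.var_ideal_ideal hom dense x])
  qed
  then show ?thesis unfolding adically_free_def by blast
qed

end
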